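(* Let $\mathbb K$ be a field, $R=\mathbb K[x_1,\dots,x_n]$, and let $I=J+K$ be an $x_i$-partition of a monomial ideal $I\subseteq R$, in which all elements of $J$ are divisible by $x_i$. If $J$ is componentwise linear, then $I=J+K$ is a Betti splitting.
   Context: An $x_i$-partition $I=J+K$: $J$ is the ideal generated by all minimal monomial generators of $I$ divisible by $x_i$, and $K$ is the ideal generated by all other minimal monomial generators of $I$. For a monomial ideal $J$, $J_{(j)}$ is the ideal generated by all homogeneous polynomials of degree $j$ belonging to $J$; $J$ is componentwise linear if $J_{(j)}$ has a linear resolution for all $j$. $I=J+K$ is a Betti splitting if $\beta_{i,\alpha}(I)=\beta_{i,\alpha}(J)+\beta_{i,\alpha}(K)+\beta_{i-1,\alpha}(J\cap K)$ for all $i$ and all $\alpha\in\mathbb Z^n$, where $\beta_{i,\alpha}(M)=\dim_{\mathbb K}\mathrm{Tor}_i(\mathbb K,M)_\alpha$ are the $\mathbb Z^n$-graded Betti numbers. *)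

theory Defs
  imports Complex_Main "HOL-Library.Poly_Mapping" "HOL-Library.Function_Algebras"
begin

section \<open>The polynomial ring and its monomial ideals\<close>

text \<open>
  \<open>('n, 'k) mpoly\<close> is \<open>R = K[x_i | i \<in> 'n]\<close>: finitely supported functions from exponent
  vectors to \<open>K\<close>, with the convolution product. The number of variables is \<open>CARD('n)\<close>.
\<close>

type_synonym ('n, 'k) mpoly = "('n \<Rightarrow>\<^sub>0 nat) \<Rightarrow>\<^sub>0 'k"

definition monom :: "('n \<Rightarrow>\<^sub>0 nat) \<Rightarrow> ('n, 'k::field) mpoly" where
  "monom m = Poly_Mapping.single m 1"

definition Var :: "'n \<Rightarrow> ('n, 'k::field) mpoly" where
  "Var i = monom (Poly_Mapping.single i 1)"

abbreviation ideal_gen :: "('n, 'k::field) mpoly set \<Rightarrow> ('n, 'k) mpoly set" where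
  "ideal_gen \<equiv> module.span (*)"

definition monomial_ideal :: "('n, 'k::field) mpoly set \<Rightarrow> bool" where
  "monomial_ideal I \<longleftrightarrow> (\<exists>S. I = ideal_gen (monom ` S))"

definition minimal_monomial_generators ::
    "('n, 'k::field) mpoly set \<Rightarrow> ('n, 'k) mpoly set \<Rightarrow> bool" where
  "minimal_monomial_generators G I \<longleftrightarrow>
     G \<subseteq> range monom \<and> ideal_gen G = I \<and> (\<forall>G'. G' \<subset> G \<longrightarrow> ideal_gen G' \<noteq> I)"

text \<open>
  A monomial ideal has exactly one minimal set of monomial generators, so the quantifier over
  \<open>G\<close> leaves no choice.
\<close>

definition x_partition ::
    "'n \<Rightarrow> ('n, 'k::field) mpoly set \<Rightarrow> ('n, 'k) mpoly set \<Rightarrow> ('n, 'k) mpoly set \<Rightarrow> bool" where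
  "x_partition i I J K \<longleftrightarrow>
     (\<exists>G. minimal_monomial_generators G I \<and>
          J = ideal_gen {g \<in> G. Var i dvd g} \<and>
          K = ideal_gen {g \<in> G. \<not> Var i dvd g})"


section \<open>Multigraded free resolutions\<close>

definition homogeneous :: "('n \<Rightarrow> int) \<Rightarrow> ('n, 'k::field) mpoly \<Rightarrow> bool" where
  "homogeneous \<alpha> p \<longleftrightarrow>
     (\<forall>m \<in> Poly_Mapping.keys p. (\<lambda>i. int (Poly_Mapping.lookup m i)) = \<alpha>)"

text \<open>
  A sequence of finitely generated \<open>\<int>\<^sup>n\<close>-graded free modules
  \<open>F\<^sub>i = \<Oplus>\<^bsub>j < grank i\<^esub> R(-gdeg i j)\<close> with an augmentation \<open>F\<^sub>0 \<rightarrow> R\<close>, given by the row \<open>aug\<close>,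
  and maps \<open>F\<^bsub>i+1\<^esub> \<rightarrow> F\<^sub>i\<close>, given by the matrices \<open>gdiff i\<close> (first index: row).
\<close>

record (overloaded) ('n, 'k) graded_seq =
  grank :: "nat \<Rightarrow> nat"
  gdeg :: "nat \<Rightarrow> nat \<Rightarrow> 'n \<Rightarrow> int"
  aug :: "nat \<Rightarrow> ('n, 'k) mpoly"
  gdiff :: "nat \<Rightarrow> nat \<Rightarrow> nat \<Rightarrow> ('n, 'k) mpoly"

definition free_module ::
    "('n, 'k::field) graded_seq \<Rightarrow> nat \<Rightarrow> (nat \<Rightarrow> ('n, 'k) mpoly) set" where
  "free_module F i = {v. \<forall>j \<ge> grank F i. v j = 0}"

definition aug_map ::
    "('n, 'k::field) graded_seq \<Rightarrow> (nat \<Rightarrow> ('n, 'k) mpoly) \<Rightarrow> ('n, 'k) mpoly" where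
  "aug_map F v = (\<Sum>j<grank F 0. aug F j * v j)"

definition diff_map ::
    "('n, 'k::field) graded_seq \<Rightarrow> nat \<Rightarrow> (nat \<Rightarrow> ('n, 'k) mpoly) \<Rightarrow> nat \<Rightarrow> ('n, 'k) mpoly" where
  "diff_map F i v = (\<lambda>k. if k < grank F i then \<Sum>j<grank F (Suc i). gdiff F i k j * v j else 0)"

text \<open>
  \<open>F\<close> is a graded free resolution \<open>\<dots> \<rightarrow> F\<^sub>1 \<rightarrow> F\<^sub>0 \<rightarrow> M \<rightarrow> 0\<close> of the ideal \<open>M\<close>, not necessarily
  minimal. The first two conditions say that all maps have degree \<open>0\<close>.
\<close>

definition free_resolution ::
    "('n, 'k::field) graded_seq \<Rightarrow> ('n, 'k) mpoly set \<Rightarrow> bool" where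
  "free_resolution F M \<longleftrightarrow>
     (\<forall>j < grank F 0. homogeneous (gdeg F 0 j) (aug F j)) \<and>
     (\<forall>i. \<forall>k < grank F i. \<forall>j < grank F (Suc i).
        homogeneous (gdeg F (Suc i) j - gdeg F i k) (gdiff F i k j)) \<and>
     aug_map F ` free_module F 0 = M \<and>
     {v \<in> free_module F 0. aug_map F v = 0} = diff_map F 0 ` free_module F 1 \<and>
     (\<forall>i. {v \<in> free_module F (Suc i). diff_map F i v = (\<lambda>_. 0)} =
          diff_map F (Suc i) ` free_module F (Suc (Suc i)))"


section \<open>Tor and Betti numbers\<close>

text \<open>
  \<open>Tor\<^sub>i(K, M)\<^sub>\<alpha>\<close> is the homology of \<open>(K \<otimes>\<^sub>R F)\<^sub>\<alpha>\<close> for a graded free resolution \<open>F\<close> of \<open>M\<close>, where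
  \<open>K = R/(x_1, \<dots>, x_n)\<close> sits in degree \<open>0\<close>. Hence \<open>(K \<otimes>\<^sub>R F\<^sub>i)\<^sub>\<alpha>\<close> has as \<open>K\<close>-basis the generators
  of \<open>F\<^sub>i\<close> of degree \<open>\<alpha>\<close>, and the induced map keeps only the constant terms of \<open>gdiff\<close>.
\<close>

definition gens_of_degree ::
    "('n, 'k::field) graded_seq \<Rightarrow> nat \<Rightarrow> ('n \<Rightarrow> int) \<Rightarrow> nat set" where
  "gens_of_degree F i \<alpha> = {j. j < grank F i \<and> gdeg F i j = \<alpha>}"

definition tensor_space ::
    "('n, 'k::field) graded_seq \<Rightarrow> nat \<Rightarrow> ('n \<Rightarrow> int) \<Rightarrow> (nat \<Rightarrow> 'k) set" where
  "tensor_space F i \<alpha> = {w. \<forall>j. j \<notin> gens_of_degree F i \<alpha> \<longrightarrow> w j = 0}"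

definition tensor_map ::
    "('n, 'k::field) graded_seq \<Rightarrow> nat \<Rightarrow> ('n \<Rightarrow> int) \<Rightarrow> (nat \<Rightarrow> 'k) \<Rightarrow> nat \<Rightarrow> 'k" where
  "tensor_map F i \<alpha> w =
     (\<lambda>k. if k \<in> gens_of_degree F i \<alpha>
          then \<Sum>j\<in>gens_of_degree F (Suc i) \<alpha>. Poly_Mapping.lookup (gdiff F i k j) 0 * w j
          else 0)"

fun tor_cycles ::
    "('n, 'k::field) graded_seq \<Rightarrow> nat \<Rightarrow> ('n \<Rightarrow> int) \<Rightarrow> (nat \<Rightarrow> 'k) set" where
  "tor_cycles F 0 \<alpha> = tensor_space F 0 \<alpha>"
| "tor_cycles F (Suc i) \<alpha> = {w \<in> tensor_space F (Suc i) \<alpha>. tensor_map F i \<alpha> w = (\<lambda>_. 0)}"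

definition tor_boundaries ::
    "('n, 'k::field) graded_seq \<Rightarrow> nat \<Rightarrow> ('n \<Rightarrow> int) \<Rightarrow> (nat \<Rightarrow> 'k) set" where
  "tor_boundaries F i \<alpha> = tensor_map F i \<alpha> ` tensor_space F (Suc i) \<alpha>"

abbreviation dimK :: "(nat \<Rightarrow> 'k::field) set \<Rightarrow> nat" where
  "dimK \<equiv> vector_space.dim (\<lambda>c w j. c * w j)"

text \<open>
  The boundaries are contained in the cycles and both are finite-dimensional, so the
  difference is the dimension of the quotient.
\<close>

definition tor_dim :: "('n, 'k::field) graded_seq \<Rightarrow> nat \<Rightarrow> ('n \<Rightarrow> int) \<Rightarrow> nat" where
  "tor_dim F i \<alpha> = dimK (tor_cycles F i \<alpha>) - dimK (tor_boundaries F i \<alpha>)"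

text \<open>
  Every monomial ideal (in finitely many variables) has a free resolution as above, and
  \<open>tor_dim\<close> does not depend on its choice.
\<close>

definition betti :: "nat \<Rightarrow> ('n \<Rightarrow> int) \<Rightarrow> ('n, 'k::field) mpoly set \<Rightarrow> nat" where
  "betti i \<alpha> M = tor_dim (SOME F. free_resolution F M) i \<alpha>"


section \<open>Componentwise linearity and Betti splittings\<close>

definition homogeneous_part ::
    "nat \<Rightarrow> ('n::finite, 'k::field) mpoly set \<Rightarrow> ('n, 'k) mpoly set" where
  "homogeneous_part j J =
     ideal_gen {p \<in> J. \<forall>m \<in> Poly_Mapping.keys p. (\<Sum>i\<in>UNIV. Poly_Mapping.lookup m i) = j}"

text \<open>
  For an ideal generated in degree \<open>d\<close>: the \<open>\<int>\<close>-graded Betti number \<open>\<beta>\<^bsub>i,c\<^esub>\<close>, which is the sum of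
  the \<open>\<beta>\<^bsub>i,\<alpha>\<^esub>\<close> with \<open>\<bar>\<alpha>\<bar> = c\<close>, vanishes unless \<open>c = i + d\<close>.
\<close>

definition linear_resolution :: "nat \<Rightarrow> ('n::finite, 'k::field) mpoly set \<Rightarrow> bool" where
  "linear_resolution d M \<longleftrightarrow>
     (\<forall>i \<alpha>. (\<Sum>l\<in>UNIV. \<alpha> l) \<noteq> int i + int d \<longrightarrow> betti i \<alpha> M = 0)"

definition componentwise_linear :: "('n::finite, 'k::field) mpoly set \<Rightarrow> bool" where
  "componentwise_linear J \<longleftrightarrow> (\<forall>j. linear_resolution j (homogeneous_part j J))"

definition betti_splitting ::
    "('n, 'k::field) mpoly set \<Rightarrow> ('n, 'k) mpoly set \<Rightarrow> ('n, 'k) mpoly set \<Rightarrow> bool" where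
  "betti_splitting I J K \<longleftrightarrow>
     I = {p + q | p q. p \<in> J \<and> q \<in> K} \<and>
     (\<forall>i \<alpha>. betti i \<alpha> I =
        betti i \<alpha> J + betti i \<alpha> K + (if i = 0 then 0 else betti (i - 1) \<alpha> (J \<inter> K)))"

end

theory Submission imports Defs begin

text \<open>
  \<open>Tor\<^sub>p(K, M)\<^sub>\<alpha>\<close> is the homology of the Koszul complex with coefficients in \<open>M\<close> in degree \<open>\<alpha>\<close>,
  whose chains are supported on the sets \<open>\<sigma>\<close> of \<open>p\<close> variables with \<open>x\<^bsup>\<alpha>-\<sigma>\<^esup> \<in> M\<close>. Counting dimensions in
  \<open>0 \<rightarrow> J \<inter> K \<rightarrow> J \<oplus> K \<rightarrow> I \<rightarrow> 0\<close> shows that \<open>I = J + K\<close> is a Betti splitting once every Koszul cycle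
  over \<open>J \<inter> K\<close> bounds both over \<open>J\<close> and over \<open>K\<close>. Over \<open>K\<close> it bounds its cone with apex \<open>x\<^sub>i\<close>, because
  elements of \<open>J \<inter> K\<close> are divisible by \<open>x\<^sub>i\<close> and the generators of \<open>K\<close> are not. Over \<open>J\<close>, minimality of the
  generators gives \<open>J \<inter> K \<subseteq> \<mm> J\<close>; hence a cycle with coefficients of degree \<open>d + 1\<close> is a cycle
  over \<open>J\<^bsub>(d)\<^esub>\<close>, and there it bounds since the homology of an ideal with a \<open>d\<close>-linear resolution
  vanishes in total degree \<open>p + d + 1\<close>.
\<close>


section \<open>Linear algebra in function spaces\<close>

text \<open>Betti numbers are defined by an arbitrarily chosen resolution, while the argument lives
  on inclusions of ideals, which resolutions do not respect. Koszul chains do: an inclusion of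
  ideals is an inclusion of chain spaces. The price is a proof that every resolution computes Koszul
  homology, and that one exists, since otherwise the choice would be meaningless; this takes up most
  of the development.

  The \<int>^n-grading makes it elementary. A homogeneous polynomial has at most one term, so a
  graded matrix is a matrix of scalars, and every graded component is a subspace of some K^m.
  Homology groups and maps between them are never formed: each comparison is an equality of
  dimension differences, obtained by mapping one space of chains onto both sides. Tor is reached by
  dimension shifting along syzygies. Cancellations are arranged to hold in every
  characteristic.\<close>

interpretation fs: vector_space "(\<lambda>c w j. c * w j) :: 'k::field \<Rightarrow> ('x \<Rightarrow> 'k) \<Rightarrow> 'x \<Rightarrow> 'k"
  by unfold_locales (auto simp: fun_eq_iff algebra_simps)

abbreviation lin :: "(('x \<Rightarrow> 'k::field) \<Rightarrow> ('y \<Rightarrow> 'k)) \<Rightarrow> bool" where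
  "lin \<equiv> Vector_Spaces.linear (\<lambda>c w j. c * w j) (\<lambda>c w j. c * w j)"

lemma lin_iff:
  "lin f \<longleftrightarrow> (\<forall>x y. f (x + y) = f x + f y) \<and> (\<forall>c x. f (\<lambda>j. c * x j) = (\<lambda>j. c * f x j))"
  by (simp add: Vector_Spaces.linear_iff fs.vector_space_axioms)

lemma lin_zero: "lin f \<Longrightarrow> f 0 = 0"
  unfolding lin_iff by (metis add_0 add_cancel_right_left)

lemma lin_diff:
  assumes "lin f"
  shows "f (x - y) = f x - f y"
proof -
  have "f (x - y) + f y = f x" using assms unfolding lin_iff by (metis diff_add_cancel)
  then show ?thesis by (simp add: eq_diff_eq)
qed

lemma subspace_iff:
  "fs.subspace S \<longleftrightarrow> 0 \<in> S \<and> (\<forall>x\<in>S. \<forall>y\<in>S. x + y \<in> S) \<and> (\<forall>c. \<forall>x\<in>S. (\<lambda>j. c * x j) \<in> S)"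
  by (auto simp: fs.subspace_def)

text \<open>Stands in for finite dimension: the ambient function space may be infinite-dimensional,
  and there \<open>fs.dim\<close> is 0 on infinite-dimensional subspaces and dimension counts
  fail.\<close>

definition fin_supp :: "('x \<Rightarrow> 'k::field) set \<Rightarrow> bool" where
  "fin_supp S \<longleftrightarrow> (\<exists>A. finite A \<and> (\<forall>w\<in>S. \<forall>j. j \<notin> A \<longrightarrow> w j = 0))"

lemma fin_supp_subset: "fin_supp T \<Longrightarrow> S \<subseteq> T \<Longrightarrow> fin_supp S"
  unfolding fin_supp_def by blast

lemma span_deltas:
  fixes w :: "'x \<Rightarrow> 'k::field"
  assumes "finite A" "\<And>j. j \<notin> A \<Longrightarrow> w j = 0"
  shows "w \<in> fs.span ((\<lambda>a j. if j = a then 1 else 0) ` A)"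
proof -
  have "w = (\<Sum>a\<in>A. (\<lambda>j. w a * (if j = a then 1 else 0)))"
  proof
    fix j
    have "(\<Sum>a\<in>A. (\<lambda>j. w a * (if j = a then 1 else 0))) j = (\<Sum>a\<in>A. w a * (if j = a then 1 else 0))"
      by (induction A rule: infinite_finite_induct) auto
    also have "\<dots> = w j" using assms by (auto simp: if_distrib cong: if_cong)
    finally show "w j = (\<Sum>a\<in>A. (\<lambda>j. w a * (if j = a then 1 else 0))) j" by simp
  qed
  also have "\<dots> \<in> fs.span ((\<lambda>a j. if j = a then 1 else 0) ` A)"
    by (intro fs.span_sum fs.span_scale fs.span_base) auto
  finally show ?thesis .
qed

lemma fin_supp_basis:
  fixes S :: "('x \<Rightarrow> 'k::field) set"
  assumes "fin_supp S" "fs.independent B0" "B0 \<subseteq> S"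
  obtains B where "B0 \<subseteq> B" "B \<subseteq> S" "fs.independent B" "S \<subseteq> fs.span B" "finite B"
proof -
  obtain A where A: "finite A" "\<forall>w\<in>S. \<forall>j. j \<notin> A \<longrightarrow> w j = 0" using assms(1) unfolding fin_supp_def by blast
  obtain B where B: "B0 \<subseteq> B" "B \<subseteq> S" "fs.independent B" "S \<subseteq> fs.span B"
    using fs.maximal_independent_subset_extend[OF assms(3,2)] by blast
  have "B \<subseteq> fs.span ((\<lambda>a j. if j = a then 1 else 0) ` A)"
    using A B(2) by (blast intro!: span_deltas[OF A(1)])
  then have "finite B"
    using fs.independent_span_bound[OF _ B(3)] A(1) by blast
  then show thesis using that B by blast
qed

lemma fin_supp_basis_exists:
  fixes S :: "('x \<Rightarrow> 'k::field) set"
  assumes "fin_supp S"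
  obtains B where "B \<subseteq> S" "fs.independent B" "S \<subseteq> fs.span B" "finite B"
  by (rule fin_supp_basis[OF assms fs.independent_empty empty_subsetI]) (rule that)

lemma fin_supp_dim_le:
  fixes S :: "('x \<Rightarrow> 'k::field) set"
  assumes "finite A" "\<forall>w\<in>S. \<forall>j. j \<notin> A \<longrightarrow> w j = 0"
  shows "fs.dim S \<le> card A"
proof -
  have "S \<subseteq> fs.span ((\<lambda>a j. if j = a then 1 else 0) ` A)"
    using assms by (blast intro!: span_deltas[OF assms(1)])
  then have "fs.dim S \<le> card ((\<lambda>a j. if j = a then 1 else 0 :: 'k) ` A)"
    using fs.dim_le_card assms(1) by blast
  also have "\<dots> \<le> card A" using assms(1) by (rule card_image_le)
  finally show ?thesis .
qed

lemma rank_nullity: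
  fixes f :: "('x \<Rightarrow> 'k::field) \<Rightarrow> ('y \<Rightarrow> 'k)"
  assumes f: "lin f" and S: "fs.subspace S" "fin_supp S"
  shows "fs.dim S = fs.dim (f ` S) + fs.dim {x\<in>S. f x = 0}"
proof -
  interpret f: Vector_Spaces.linear "\<lambda>c (w::'x\<Rightarrow>'k) j. c * w j" "\<lambda>c (w::'y\<Rightarrow>'k) j. c * w j" f by (rule f)
  let ?Z = "{x\<in>S. f x = 0}"
  have Z: "fs.subspace ?Z"
    using S(1) by (auto simp: fs.subspace_def f.add f.scale f.zero)
  obtain B0 where B0: "B0 \<subseteq> ?Z" "fs.independent B0" "?Z \<subseteq> fs.span B0" "finite B0"
    by (rule fin_supp_basis_exists[OF fin_supp_subset[OF S(2), of ?Z]]) auto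
  then have "B0 \<subseteq> S" by auto
  then obtain B where B: "B0 \<subseteq> B" "B \<subseteq> S" "fs.independent B" "S \<subseteq> fs.span B" "finite B"
    by (rule fin_supp_basis[OF S(2) B0(2)])
  let ?C = "B - B0"
  have spC: "fs.span ?C \<inter> fs.span B0 \<subseteq> {0}"
  proof
    fix x assume x: "x \<in> fs.span ?C \<inter> fs.span B0"
    have 1: "x \<in> fs.span (B \<inter> B0)" using x B(1) by (simp add: Int_absorb1)
    show "x \<in> {0}"
    proof -
      have r1: "fs.representation B x b = 0" if "b \<notin> ?C" for b
        using fs.representation_extend[of B x ?C] x B(3) that
          fs.representation_ne_zero[of ?C x b] by auto
      have r2: "fs.representation B x b = 0" if "b \<notin> B0" for b
        using fs.representation_extend[of B x B0] x B(1,3) that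
          fs.representation_ne_zero[of B0 x b] by auto
      have "fs.representation B x = (\<lambda>b. 0)" using r1 r2 by (auto simp: fun_eq_iff)
      moreover have "x \<in> fs.span B" using x fs.span_mono[OF B(1)] by auto
      ultimately show ?thesis
        using fs.sum_nonzero_representation_eq[OF B(3), of x] by simp
    qed
  qed
  have "inj_on f (fs.span ?C)"
  proof (rule inj_onI)
    fix x y assume xy: "x \<in> fs.span ?C" "y \<in> fs.span ?C" "f x = f y"
    have "x - y \<in> fs.span ?C" using xy fs.span_diff by blast
    moreover have "f (x - y) = 0" using xy(3) by (simp add: f.diff)
    moreover have "x - y \<in> S"
      using calculation(1) fs.span_minimal[of ?C S] B(2) S(1) by auto
    ultimately have "x - y \<in> fs.span ?C \<inter> fs.span B0" using B0(3) by blast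
    then show "x = y" using spC by auto
  qed
  then have ind: "fs.independent (f ` ?C)" and inj: "inj_on f ?C"
    using f.independent_injective_image[of ?C] B(3) fs.independent_mono[of B ?C] inj_on_subset[of f "fs.span ?C" ?C] fs.span_superset
    by blast+
  have "f ` S \<subseteq> fs.span (f ` ?C)"
  proof
    fix y assume "y \<in> f ` S"
    then have "y \<in> f ` fs.span B" using B(4) by auto
    then have "y \<in> fs.span (f ` B)" by (simp add: f.span_image)
    moreover have "f ` B \<subseteq> insert 0 (f ` ?C)" using B0(1) by auto
    ultimately have "y \<in> fs.span (insert 0 (f ` ?C))" using fs.span_mono by blast
    then show "y \<in> fs.span (f ` ?C)" by simp
  qed
  moreover have "f ` ?C \<subseteq> f ` S" using B(2) by auto
  ultimately have "fs.dim (f ` S) = card (f ` ?C)"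
    using ind fs.basis_card_eq_dim[of "f ` ?C" "f ` S"] by simp
  also have "\<dots> = card B - card B0" using inj B(1) B0(4) by (simp add: card_image card_Diff_subset)
  finally have "fs.dim (f ` S) = card B - card B0" .
  moreover have "fs.dim S = card B" using fs.basis_card_eq_dim[OF B(2,4,3)] by simp
  moreover have "fs.dim ?Z = card B0" using fs.basis_card_eq_dim[OF B0(1,3,2)] by simp
  moreover have "card B0 \<le> card B" using B(1,5) by (simp add: card_mono)
  ultimately show ?thesis by simp
qed

lemma dim_mono_fin:
  fixes S T :: "('x \<Rightarrow> 'k::field) set"
  assumes "fin_supp T" "S \<subseteq> T"
  shows "fs.dim S \<le> fs.dim T"
proof -
  obtain B where B: "B \<subseteq> T" "fs.independent B" "T \<subseteq> fs.span B" "finite B"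
    by (rule fin_supp_basis_exists[OF assms(1)])
  then have "fs.dim S \<le> card B" using fs.dim_le_card[of S B] assms(2) by simp
  then show ?thesis using fs.basis_card_eq_dim[OF B(1,3,2)] by simp
qed

lemma dim_equal_subspace:
  fixes S T :: "('x \<Rightarrow> 'k::field) set"
  assumes "fin_supp T" "fs.subspace S" "S \<subseteq> T" "fs.dim T \<le> fs.dim S"
  shows "S = T"
proof -
  obtain B0 where B0: "B0 \<subseteq> S" "fs.independent B0" "S \<subseteq> fs.span B0" "finite B0"
    by (rule fin_supp_basis_exists[OF fin_supp_subset[OF assms(1,3)]])
  then have "B0 \<subseteq> T" using assms(3) by blast
  then obtain B where B: "B0 \<subseteq> B" "B \<subseteq> T" "fs.independent B" "T \<subseteq> fs.span B" "finite B"
    by (rule fin_supp_basis[OF assms(1) B0(2)])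
  have "card B \<le> card B0" using fs.basis_card_eq_dim[OF B0(1,3,2)] fs.basis_card_eq_dim[OF B(2,4,3)] assms(4) by simp
  then have "B0 = B" using B by (simp add: card_seteq)
  then have "T \<subseteq> fs.span S" using B(4) fs.span_mono[OF B0(1)] by auto
  then show ?thesis using assms(3) fs.span_minimal[OF subset_refl assms(2)] by blast
qed

lemma dim_zero_set [simp]: "fs.dim {0 :: 'x \<Rightarrow> 'k::field} = 0"
  using fs.dim_span_eq_card_independent[OF fs.independent_empty] by simp

lemma dim_image_inj:
  fixes f :: "('x \<Rightarrow> 'k::field) \<Rightarrow> ('y \<Rightarrow> 'k)"
  assumes f: "lin f" and S: "fs.subspace S" "fin_supp S" and inj: "\<And>x. x \<in> S \<Longrightarrow> f x = 0 \<Longrightarrow> x = 0"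
  shows "fs.dim (f ` S) = fs.dim S"
proof -
  have "f 0 = 0" using f by (rule lin_zero)
  then have "{x\<in>S. f x = 0} = {0}" using inj S(1) by (auto simp: subspace_iff)
  then show ?thesis using rank_nullity[OF f S] by simp
qed

text \<open>The direct sum is modelled by functions on \<open>'x + 'x\<close>. Rank-nullity is
  applied to the first projection, whose kernel is a copy of \<open>T\<close>, and to the addition
  map, whose kernel consists of the pairs \<open>(x, -x)\<close> with \<open>x\<close> in both
  spaces.\<close>

lemma dim_sum_Int:
  fixes S T :: "('x \<Rightarrow> 'k::field) set"
  assumes S: "fs.subspace S" "fin_supp S" and T: "fs.subspace T" "fin_supp T"
  shows "fs.dim {x + y |x y. x \<in> S \<and> y \<in> T} + fs.dim (S \<inter> T) = fs.dim S + fs.dim T"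
proof -
  define R :: "('x + 'x \<Rightarrow> 'k) set" where "R = {w. (\<lambda>j. w (Inl j)) \<in> S \<and> (\<lambda>j. w (Inr j)) \<in> T}"
  define p :: "('x + 'x \<Rightarrow> 'k) \<Rightarrow> 'x \<Rightarrow> 'k" where "p = (\<lambda>w j. w (Inl j))"
  define q :: "('x + 'x \<Rightarrow> 'k) \<Rightarrow> 'x \<Rightarrow> 'k" where "q = (\<lambda>w j. w (Inr j))"
  define s :: "('x + 'x \<Rightarrow> 'k) \<Rightarrow> 'x \<Rightarrow> 'k" where "s = (\<lambda>w j. w (Inl j) + w (Inr j))"
  have lins: "lin p" "lin q" "lin s"
    unfolding lin_iff p_def q_def s_def by (auto simp: fun_eq_iff algebra_simps)
  have R: "fs.subspace R"
    using S(1) T(1) unfolding R_def subspace_iff plus_fun_def zero_fun_def by auto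
  have fR: "fin_supp R"
  proof -
    obtain A B where "finite A" "\<forall>w\<in>S. \<forall>j. j \<notin> A \<longrightarrow> w j = 0" "finite B" "\<forall>w\<in>T. \<forall>j. j \<notin> B \<longrightarrow> w j = 0"
      using S(2) T(2) unfolding fin_supp_def by blast
    then show ?thesis
      unfolding fin_supp_def R_def
      by (intro exI[of _ "A <+> B"]) (auto, metis InlI InrI sum.exhaust)
  qed
  have mem: "case_sum x y \<in> R" if "x \<in> S" "y \<in> T" for x y using that by (simp add: R_def)
  have pR: "p ` R = S"
  proof
    show "p ` R \<subseteq> S" by (auto simp: p_def R_def)
    show "S \<subseteq> p ` R"
    proof
      fix x assume "x \<in> S"
      then have "case_sum x 0 \<in> R" using mem T(1) by (simp add: subspace_iff)
      then show "x \<in> p ` R" by (rule rev_image_eqI) (simp add: p_def)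
    qed
  qed
  have sR: "s ` R = {x + y |x y. x \<in> S \<and> y \<in> T}"
  proof
    show "s ` R \<subseteq> {x + y |x y. x \<in> S \<and> y \<in> T}" by (auto simp: s_def R_def plus_fun_def)
    show "{x + y |x y. x \<in> S \<and> y \<in> T} \<subseteq> s ` R"
    proof clarify
      fix x y assume "x \<in> S" "y \<in> T"
      then have "case_sum x y \<in> R" by (rule mem)
      then show "x + y \<in> s ` R" by (rule rev_image_eqI) (simp add: s_def plus_fun_def)
    qed
  qed
  let ?Kp = "{w\<in>R. p w = 0}" and ?Ks = "{w\<in>R. s w = 0}"
  have sub: "fs.subspace ?Kp" "fs.subspace ?Ks"
    using R lins by (auto simp: subspace_iff lin_iff lin_zero[OF lins(1)] lin_zero[OF lins(3)] fun_eq_iff)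
  have "q ` ?Kp = T"
  proof
    show "q ` ?Kp \<subseteq> T" by (auto simp: q_def R_def)
    show "T \<subseteq> q ` ?Kp"
    proof
      fix y assume "y \<in> T"
      then have "case_sum 0 y \<in> ?Kp" using mem[of 0 y] S(1) by (auto simp: p_def subspace_iff fun_eq_iff)
      then show "y \<in> q ` ?Kp" by (rule rev_image_eqI) (simp add: q_def)
    qed
  qed
  moreover have "fs.dim (q ` ?Kp) = fs.dim ?Kp"
    by (rule dim_image_inj[OF lins(2) sub(1) fin_supp_subset[OF fR]])
       (auto simp: p_def q_def fun_eq_iff split: sum.splits, metis sum.exhaust)
  moreover have "p ` ?Ks = S \<inter> T"
  proof
    show "p ` ?Ks \<subseteq> S \<inter> T"
    proof clarify
      fix w assume w: "w \<in> R" "s w = 0"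
      have "p w = (\<lambda>j. (-1) * q w j)" using w(2) by (auto simp: s_def p_def q_def fun_eq_iff eq_neg_iff_add_eq_0)
      moreover have "q w \<in> T" using w by (simp add: q_def R_def)
      ultimately have "p w \<in> T" using T(1) unfolding subspace_iff by metis
      then show "p w \<in> S \<inter> T" using w by (simp add: p_def R_def)
    qed
    show "S \<inter> T \<subseteq> p ` ?Ks"
    proof
      fix x assume x: "x \<in> S \<inter> T"
      then have "(\<lambda>j. (-1) * x j) \<in> T" using T(1) unfolding subspace_iff by blast
      then have "case_sum x (\<lambda>j. (-1) * x j) \<in> ?Ks" using mem[of x] x by (auto simp: s_def fun_eq_iff)
      then show "x \<in> p ` ?Ks" by (rule rev_image_eqI) (simp add: p_def)
    qed
  qed
  moreover have "fs.dim (p ` ?Ks) = fs.dim ?Ks"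
    by (rule dim_image_inj[OF lins(1) sub(2) fin_supp_subset[OF fR]])
       (auto simp: p_def s_def fun_eq_iff split: sum.splits, metis add_0 sum.exhaust)
  ultimately show ?thesis
    using rank_nullity[OF lins(1) R fR] rank_nullity[OF lins(3) R fR] pR sR by simp
qed

lemma subspace_image: "lin f \<Longrightarrow> fs.subspace S \<Longrightarrow> fs.subspace (f ` S)"
  unfolding subspace_iff lin_iff by (auto simp: image_iff) (metis fs.scale_zero_left zero_fun_def, metis+)

lemma subspace_preimage:
  assumes f: "lin f" and S: "fs.subspace S" and T: "fs.subspace T"
  shows "fs.subspace {x\<in>S. f x \<in> T}"
proof -
  have "f (x + y) \<in> T" if "f x \<in> T" "f y \<in> T" for x y
    using that f T unfolding lin_iff subspace_iff by simp
  moreover have "f (\<lambda>j. c * x j) \<in> T" if "f x \<in> T" for c x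
    using that f T unfolding lin_iff subspace_iff by simp
  ultimately show ?thesis using lin_zero[OF f] S T unfolding subspace_iff by simp
qed

lemma subspace_kernel: "lin f \<Longrightarrow> fs.subspace S \<Longrightarrow> fs.subspace {x\<in>S. f x = 0}"
  using subspace_preimage[of f S "{0}"] by simp

text \<open>The map induces an isomorphism from Z/Z0 to A/A0: \<open>Z0\<close> is the full preimage
  of \<open>A0\<close>, so it contains the kernel, which cancels in the difference. It is used in
  pairs, with two maps out of the same \<open>Z\<close> and \<open>Z0\<close>.\<close>

lemma dim_quotient:
  fixes f :: "('x \<Rightarrow> 'k::field) \<Rightarrow> ('y \<Rightarrow> 'k)"
  assumes f: "lin f" and Z: "fs.subspace Z" "fin_supp Z" and Z0: "fs.subspace Z0" "Z0 \<subseteq> Z"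
    and A0: "A0 \<subseteq> A" and im: "f ` Z = A" and pre: "\<And>x. x \<in> Z \<Longrightarrow> x \<in> Z0 \<longleftrightarrow> f x \<in> A0" and A00: "0 \<in> A0"
  shows "int (fs.dim Z) - int (fs.dim Z0) = int (fs.dim A) - int (fs.dim A0)"
proof -
  have "f ` Z0 = A0" using im pre A0 Z0(2) by (fastforce simp: image_iff)
  moreover have "{x\<in>Z0. f x = 0} = {x\<in>Z. f x = 0}" using pre Z0(2) A00 by auto
  ultimately show ?thesis
    using rank_nullity[OF f Z] rank_nullity[OF f Z0(1) fin_supp_subset[OF Z(2) Z0(2)]] im by simp
qed

section \<open>Koszul homology of monotone families\<close>

text \<open>Koszul signs require a linear order of the variables; an arbitrary injection into
  \<open>nat\<close> supplies one for the unordered index type.\<close>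

definition var_index :: "'n::finite \<Rightarrow> nat" where
  "var_index = (SOME f. inj f)"

lemma inj_var_index: "inj (var_index :: 'n::finite \<Rightarrow> nat)"
proof -
  obtain f :: "'n \<Rightarrow> nat" and n where "inj_on f UNIV"
    using finite_imp_inj_to_nat_seg[of "UNIV :: 'n set"] by auto
  then show ?thesis unfolding var_index_def by (rule someI[of inj])
qed

definition kos_sign :: "'n::finite \<Rightarrow> 'n set \<Rightarrow> 'k::field" where
  "kos_sign l \<tau> = (-1) ^ card {m\<in>\<tau>. var_index m < var_index l}"

lemma kos_sign_square: "kos_sign l \<tau> * kos_sign l \<tau> = 1"
  by (simp add: kos_sign_def flip: power_add mult_2)

lemma kos_sign_square_left: "kos_sign l \<tau> * (kos_sign l \<tau> * x) = x"
  by (metis kos_sign_square mult.assoc mult_1)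

lemma kos_sign_insert:
  assumes "m \<notin> \<tau>"
  shows "kos_sign l (insert m \<tau>) = (if var_index m < var_index l then - kos_sign l \<tau> else kos_sign l \<tau>)"
proof -
  have "{x \<in> insert m \<tau>. var_index x < var_index l} =
    (if var_index m < var_index l then insert m {x \<in> \<tau>. var_index x < var_index l}
     else {x \<in> \<tau>. var_index x < var_index l})" by auto
  then show ?thesis using assms by (simp add: kos_sign_def)
qed

lemma kos_sign_swap:
  assumes "l \<noteq> m" "l \<notin> \<tau>" "m \<notin> \<tau>"
  shows "(kos_sign l \<tau> * kos_sign m (insert l \<tau>) :: 'k::field) = - (kos_sign m \<tau> * kos_sign l (insert m \<tau>))"
proof -
  have "var_index l \<noteq> var_index m" using assms(1) inj_var_index by (auto dest: injD)
  then show ?thesis using assms(2,3) by (simp add: kos_sign_insert)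
qed

text \<open>The Koszul differential, read off coefficientwise. The factor x_l is invisible because
  multiplication by a variable will be an inclusion of graded components; \<open>j\<close> is a
  module coordinate that is carried along.\<close>

definition bd :: "('n::finite set \<times> 'x \<Rightarrow> 'k::field) \<Rightarrow> 'n set \<times> 'x \<Rightarrow> 'k" where
  "bd t = (\<lambda>(\<tau>, j). \<Sum>l\<in>-\<tau>. kos_sign l \<tau> * t (insert l \<tau>, j))"

lemma bd_apply: "bd t (\<tau>, j) = (\<Sum>l\<in>-\<tau>. kos_sign l \<tau> * t (insert l \<tau>, j))"
  by (simp add: bd_def)

lemma lin_bd: "lin bd"
  by (auto simp: lin_iff bd_def fun_eq_iff algebra_simps sum.distrib sum_distrib_left)

text \<open>The swap has no fixed point on \<open>P\<close>, and comparing values of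
  \<open>f\<close> selects one pair from each orbit, so terms cancel in pairs. That the sum equals
  its own negative would not suffice in characteristic 2.\<close>

lemma sum_antisym:
  fixes g :: "'a \<times> 'a \<Rightarrow> 'k::ab_group_add" and f :: "'a \<Rightarrow> nat"
  assumes fin: "finite P" and sym: "\<And>x y. (x, y) \<in> P \<Longrightarrow> (y, x) \<in> P"
    and g: "\<And>x y. (x, y) \<in> P \<Longrightarrow> g (x, y) = - g (y, x)" and f: "\<And>x y. (x, y) \<in> P \<Longrightarrow> f x \<noteq> f y"
  shows "sum g P = 0"
proof -
  let ?Q = "{(x, y)\<in>P. f x < f y}"
  have P: "P = ?Q \<union> prod.swap ` ?Q"
  proof (intro equalityI subsetI)
    fix z assume z: "z \<in> P"
    obtain x y where xy: "z = (x, y)" by (cases z)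
    consider "f x < f y" | "f y < f x" using f z xy by fastforce
    then show "z \<in> ?Q \<union> prod.swap ` ?Q"
    proof cases
      case 2
      then have "(y, x) \<in> ?Q" using sym z xy by simp
      then have "z \<in> prod.swap ` ?Q" using xy by (intro rev_image_eqI[of "(y, x)"]) auto
      then show ?thesis ..
    qed (use z xy in simp)
  qed (use sym in auto)
  have "?Q \<inter> prod.swap ` ?Q = {}" by auto
  moreover have "finite ?Q" using fin by (rule finite_subset[rotated]) auto
  ultimately have "sum g P = sum g ?Q + sum g (prod.swap ` ?Q)"
    by (subst P) (intro sum.union_disjoint, auto)
  also have "sum g (prod.swap ` ?Q) = (\<Sum>z\<in>?Q. g (prod.swap z))"
    by (simp add: sum.reindex)
  also have "\<dots> = (\<Sum>z\<in>?Q. - g z)"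
  proof (intro sum.cong refl)
    fix z assume z: "z \<in> ?Q"
    obtain x y where "z = (x, y)" by (cases z)
    then show "g (prod.swap z) = - g z" using z sym g[of y x] by simp
  qed
  finally show ?thesis by (simp add: sum_negf)
qed

lemma bd_bd: "bd (bd t) = 0"
proof
  fix z show "bd (bd t) z = 0 z"
  proof (cases z)
    case (Pair \<tau> j)
    let ?g = "\<lambda>(l, m). kos_sign l \<tau> * (kos_sign m (insert l \<tau>) * t (insert m (insert l \<tau>), j))"
    have "bd (bd t) (\<tau>, j) = (\<Sum>l\<in>-\<tau>. \<Sum>m\<in>- insert l \<tau>. ?g (l, m))"
      by (simp add: bd_apply sum_distrib_left)
    also have "\<dots> = sum ?g (SIGMA l:-\<tau>. - insert l \<tau>)" by (subst sum.Sigma) auto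
    also have "\<dots> = 0"
    proof (rule sum_antisym[where f = var_index])
      fix l m assume "(l, m) \<in> (SIGMA l:-\<tau>. - insert l \<tau>)"
      then have lm: "l \<noteq> m" "l \<notin> \<tau>" "m \<notin> \<tau>" by auto
      then show "(m, l) \<in> (SIGMA l:-\<tau>. - insert l \<tau>)" by auto
      show "var_index l \<noteq> var_index m" using lm(1) inj_var_index by (auto dest: injD)
      show "?g (l, m) = - ?g (m, l)"
      proof -
        have "?g (l, m) = (kos_sign l \<tau> * kos_sign m (insert l \<tau>)) * t (insert m (insert l \<tau>), j)"
          by (simp add: mult.assoc)
        also have "\<dots> = - (kos_sign m \<tau> * kos_sign l (insert m \<tau>)) * t (insert l (insert m \<tau>), j)"
          by (simp only: kos_sign_swap[OF lm] insert_commute[of m l \<tau>])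
        finally show ?thesis by (simp only: prod.case mult.assoc minus_mult_left)
      qed
    qed simp
    finally show ?thesis using Pair by simp
  qed
qed

text \<open>Wedge product with the variable \<open>v j\<close>, the homotopy that contracts the
  Koszul complex. The apex may vary with \<open>j\<close> since \<open>bd\<close> acts on each
  module coordinate separately.\<close>

definition cone :: "('x \<Rightarrow> 'n::finite) \<Rightarrow> ('n set \<times> 'x \<Rightarrow> 'k::field) \<Rightarrow> 'n set \<times> 'x \<Rightarrow> 'k" where
  "cone v t = (\<lambda>(\<sigma>, j). if v j \<in> \<sigma> then kos_sign (v j) (\<sigma> - {v j}) * t (\<sigma> - {v j}, j) else 0)"

text \<open>Off the apex, only the summand \<open>l = v j\<close> of \<open>bd (cone v t)\<close>
  survives. At a set containing the apex, the two expressions cancel by the sign rule for exchanging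
  variables, except for the summand of \<open>bd t\<close> that puts the apex back.\<close>

lemma cone_homotopy: "bd (cone v t) (\<tau>, j) + cone v (bd t) (\<tau>, j) = t (\<tau>, j)"
proof (cases "v j \<in> \<tau>")
  case False
  have "bd (cone v t) (\<tau>, j) = (\<Sum>l\<in>-\<tau>. if l = v j then t (\<tau>, j) else 0)"
    unfolding bd_apply using False
    by (intro sum.cong refl) (auto simp: cone_def kos_sign_square_left)
  also have "\<dots> = t (\<tau>, j)" using False by simp
  finally show ?thesis using False by (simp add: cone_def)
next
  case True
  define l where "l = v j"
  define \<rho> where "\<rho> = \<tau> - {l}"
  have \<tau>: "\<tau> = insert l \<rho>" "l \<notin> \<rho>" using True by (auto simp: \<rho>_def l_def)
  have "bd (cone v t) (\<tau>, j) = (\<Sum>m\<in>-\<tau>. kos_sign m \<tau> * (kos_sign l (insert m \<rho>) * t (insert m \<rho>, j)))"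
    unfolding bd_apply
  proof (intro sum.cong refl)
    fix m assume "m \<in> -\<tau>"
    then have "insert m \<tau> - {l} = insert m \<rho>" "l \<in> insert m \<tau>" using True by (auto simp: \<rho>_def l_def)
    then show "kos_sign m \<tau> * cone v t (insert m \<tau>, j) = kos_sign m \<tau> * (kos_sign l (insert m \<rho>) * t (insert m \<rho>, j))"
      by (simp add: cone_def flip: l_def)
  qed
  also have "\<dots> = (\<Sum>m\<in>-\<tau>. - (kos_sign l \<rho> * (kos_sign m \<rho> * t (insert m \<rho>, j))))"
  proof (intro sum.cong refl)
    fix m assume "m \<in> -\<tau>"
    then have m: "m \<notin> \<rho>" "m \<noteq> l" by (auto simp: \<tau>)
    then have "var_index l \<noteq> var_index m" using inj_var_index by (auto dest: injD)
    then show "kos_sign m \<tau> * (kos_sign l (insert m \<rho>) * t (insert m \<rho>, j)) =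
      - (kos_sign l \<rho> * (kos_sign m \<rho> * t (insert m \<rho>, j)))"
      using m \<tau>(2) by (simp add: \<tau>(1) kos_sign_insert mult.left_commute)
  qed
  also have "\<dots> = - (kos_sign l \<rho> * (\<Sum>m\<in>-\<tau>. kos_sign m \<rho> * t (insert m \<rho>, j)))"
    by (simp add: sum_negf sum_distrib_left)
  finally have 1: "bd (cone v t) (\<tau>, j) = - (kos_sign l \<rho> * (\<Sum>m\<in>-\<tau>. kos_sign m \<rho> * t (insert m \<rho>, j)))" .
  have "- \<rho> = insert l (-\<tau>)" "l \<notin> -\<tau>" using \<tau> by auto
  moreover have "\<rho> - {l} = \<rho>" using \<tau>(2) by auto
  ultimately have "cone v (bd t) (\<tau>, j) = kos_sign l \<rho> * (kos_sign l \<rho> * t (\<tau>, j) + (\<Sum>m\<in>-\<tau>. kos_sign m \<rho> * t (insert m \<rho>, j)))"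
    using True by (simp add: cone_def bd_apply \<tau>(1) flip: l_def \<rho>_def)
  then show ?thesis unfolding 1 by (simp add: algebra_simps kos_sign_square_left)
qed

lemma bd_cone:
  assumes "bd t = 0"
  shows "bd (cone v t) = t"
proof
  fix z show "bd (cone v t) z = t z"
  proof (cases z)
    case (Pair \<tau> j)
    have "cone v (bd t) (\<tau>, j) = 0" by (simp add: cone_def assms)
    then show ?thesis using cone_homotopy[of v t \<tau> j] Pair by simp
  qed
qed

section \<open>Koszul chains of a graded module in a fixed multidegree\<close>

definition shift :: "('n \<Rightarrow> int) \<Rightarrow> 'n set \<Rightarrow> 'n \<Rightarrow> int" where
  "shift \<alpha> \<sigma> = (\<lambda>l. \<alpha> l - (if l \<in> \<sigma> then 1 else 0))"

lemma shift_empty [simp]: "shift \<alpha> {} = \<alpha>"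
  by (simp add: shift_def)

lemma shift_antimono: "\<sigma> \<subseteq> \<tau> \<Longrightarrow> shift \<alpha> \<tau> \<le> shift \<alpha> \<sigma>"
  by (auto simp: shift_def le_fun_def)

text \<open>
  A graded module whose components lie in \<open>K\<^sup>m\<close> and on which multiplication by a monomial
  is an inclusion \<open>N \<beta> \<subseteq> N \<gamma>\<close>; submodules of graded free modules are of this kind.
\<close>

definition graded_module :: "nat \<Rightarrow> (('n \<Rightarrow> int) \<Rightarrow> (nat \<Rightarrow> 'k::field) set) \<Rightarrow> bool" where
  "graded_module m N \<longleftrightarrow> (\<forall>\<beta>. fs.subspace (N \<beta>)) \<and> (\<forall>\<beta> \<gamma>. \<beta> \<le> \<gamma> \<longrightarrow> N \<beta> \<subseteq> N \<gamma>) \<and>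
     (\<forall>\<beta>. \<forall>w\<in>N \<beta>. \<forall>j\<ge>m. w j = 0)"

text \<open>The degree \<open>\<alpha>\<close> strand of the \<open>p\<close>-th Koszul module of
  \<open>N\<close>. All \<open>p\<close> and all \<open>N\<close> share one ambient function space,
  so that chains over different modules can be intersected and added, and a single \<open>bd\<close>
  serves them all.\<close>

definition kos :: "(('n::finite \<Rightarrow> int) \<Rightarrow> (nat \<Rightarrow> 'k::field) set) \<Rightarrow> nat \<Rightarrow> ('n \<Rightarrow> int) \<Rightarrow> ('n set \<times> nat \<Rightarrow> 'k) set" where
  "kos N p \<alpha> = {t. \<forall>\<sigma>. (\<lambda>j. t (\<sigma>, j)) \<in> N (shift \<alpha> \<sigma>) \<and> (card \<sigma> \<noteq> p \<longrightarrow> (\<forall>j. t (\<sigma>, j) = 0))}"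

definition kos_cycles :: "(('n::finite \<Rightarrow> int) \<Rightarrow> (nat \<Rightarrow> 'k::field) set) \<Rightarrow> nat \<Rightarrow> ('n \<Rightarrow> int) \<Rightarrow> ('n set \<times> nat \<Rightarrow> 'k) set" where
  "kos_cycles N p \<alpha> = {t\<in>kos N p \<alpha>. bd t = 0}"

definition kos_bounds :: "(('n::finite \<Rightarrow> int) \<Rightarrow> (nat \<Rightarrow> 'k::field) set) \<Rightarrow> nat \<Rightarrow> ('n \<Rightarrow> int) \<Rightarrow> ('n set \<times> nat \<Rightarrow> 'k) set" where
  "kos_bounds N p \<alpha> = bd ` kos N (Suc p) \<alpha>"

lemma subspace_sum_pointwise:
  assumes "fs.subspace S" "\<And>l. l \<in> A \<Longrightarrow> (\<lambda>j. f l j) \<in> S"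
  shows "(\<lambda>j. \<Sum>l\<in>A. f l j) \<in> S"
proof -
  have "(\<lambda>j. \<Sum>l\<in>A. f l j) = (\<Sum>l\<in>A. (\<lambda>j. f l j))"
    by (induction A rule: infinite_finite_induct) (auto simp: fun_eq_iff)
  then show ?thesis using fs.subspace_sum[OF assms(1), of A] assms(2) by simp
qed

lemma subspace_kos:
  assumes "graded_module m N"
  shows "fs.subspace (kos N p \<alpha>)"
proof -
  have "fs.subspace (N \<beta>)" for \<beta> using assms by (simp add: graded_module_def)
  then show ?thesis
    unfolding subspace_iff kos_def by (auto simp: plus_fun_def zero_fun_def)
qed

lemma fin_supp_kos:
  fixes N :: "('n::finite \<Rightarrow> int) \<Rightarrow> (nat \<Rightarrow> 'k::field) set"
  assumes "graded_module m N"
  shows "fin_supp (kos N p \<alpha>)"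
  unfolding fin_supp_def
proof (intro exI conjI ballI allI impI)
  show "finite ((UNIV :: 'n set set) \<times> {..<m})" by simp
  fix t and z :: "'n set \<times> nat"
  assume t: "t \<in> kos N p \<alpha>" and z: "z \<notin> UNIV \<times> {..<m}"
  obtain \<sigma> j where zj: "z = (\<sigma>, j)" by (cases z)
  have "(\<lambda>j. t (\<sigma>, j)) \<in> N (shift \<alpha> \<sigma>)" "j \<ge> m"
    using t z by (auto simp: kos_def zj)
  then show "t z = 0"
    using assms unfolding graded_module_def zj by (elim conjE) (drule spec, drule (1) bspec, simp)
qed

lemma bd_kos:
  assumes N: "graded_module m N" and t: "t \<in> kos N (Suc p) \<alpha>"
  shows "bd t \<in> kos N p \<alpha>"
  unfolding kos_def
proof (intro CollectI allI conjI impI)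
  fix \<tau>
  have sub: "fs.subspace (N (shift \<alpha> \<tau>))" using N by (simp add: graded_module_def)
  have "(\<lambda>j. t (insert l \<tau>, j)) \<in> N (shift \<alpha> \<tau>)" for l
  proof -
    have "(\<lambda>j. t (insert l \<tau>, j)) \<in> N (shift \<alpha> (insert l \<tau>))" using t by (simp add: kos_def)
    moreover have "N (shift \<alpha> (insert l \<tau>)) \<subseteq> N (shift \<alpha> \<tau>)"
      using N shift_antimono[of \<tau> "insert l \<tau>" \<alpha>] unfolding graded_module_def by blast
    ultimately show ?thesis by blast
  qed
  then have "(\<lambda>j. kos_sign l \<tau> * t (insert l \<tau>, j)) \<in> N (shift \<alpha> \<tau>)" for l
    using sub unfolding subspace_iff by fast
  then show "(\<lambda>j. bd t (\<tau>, j)) \<in> N (shift \<alpha> \<tau>)"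
    unfolding bd_apply by (intro subspace_sum_pointwise[OF sub])
  fix j assume "card \<tau> \<noteq> p"
  then have "t (insert l \<tau>, j) = 0" if "l \<notin> \<tau>" for l
    using t that by (simp add: kos_def)
  then show "bd t (\<tau>, j) = 0" by (simp add: bd_apply)
qed

lemma bd_kos_0:
  assumes "t \<in> kos N 0 \<alpha>"
  shows "bd t = 0"
proof
  fix z show "bd t z = 0 z"
    using assms by (cases z) (simp add: bd_apply kos_def)
qed

lemma kos_bounds_subset_cycles:
  assumes "graded_module m N"
  shows "kos_bounds N p \<alpha> \<subseteq> kos_cycles N p \<alpha>"
  using bd_kos[OF assms] by (auto simp: kos_bounds_def kos_cycles_def bd_bd)

lemma subspace_kos_bounds: "graded_module m N \<Longrightarrow> fs.subspace (kos_bounds N p \<alpha>)"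
  unfolding kos_bounds_def by (rule subspace_image[OF lin_bd subspace_kos])

lemma fin_supp_kos_cycles: "graded_module m N \<Longrightarrow> fin_supp (kos_cycles N p \<alpha>)"
  by (rule fin_supp_subset[OF fin_supp_kos]) (auto simp: kos_cycles_def)

lemma fin_supp_kos_bounds: "graded_module m N \<Longrightarrow> fin_supp (kos_bounds N p \<alpha>)"
  by (rule fin_supp_subset[OF fin_supp_kos_cycles kos_bounds_subset_cycles])

definition kos_dim :: "(('n::finite \<Rightarrow> int) \<Rightarrow> (nat \<Rightarrow> 'k::field) set) \<Rightarrow> nat \<Rightarrow> ('n \<Rightarrow> int) \<Rightarrow> nat" where
  "kos_dim N p \<alpha> = fs.dim (kos_cycles N p \<alpha>) - fs.dim (kos_bounds N p \<alpha>)"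

lemma int_kos_dim:
  assumes "graded_module m N"
  shows "int (kos_dim N p \<alpha>) = int (fs.dim (kos_cycles N p \<alpha>)) - int (fs.dim (kos_bounds N p \<alpha>))"
  using dim_mono_fin[OF fin_supp_kos_cycles[OF assms] kos_bounds_subset_cycles[OF assms]]
  by (simp add: kos_dim_def)

lemma kos_dim_eq_0:
  assumes "graded_module m N" "kos_dim N p \<alpha> = 0"
  shows "kos_bounds N p \<alpha> = kos_cycles N p \<alpha>"
  using dim_equal_subspace[OF fin_supp_kos_cycles[OF assms(1)] subspace_kos_bounds[OF assms(1)]
    kos_bounds_subset_cycles[OF assms(1)]] assms(2)
  by (simp add: kos_dim_def)

lemma dim_kos_Suc:
  assumes "graded_module m N"
  shows "fs.dim (kos N (Suc p) \<alpha>) = fs.dim (kos_bounds N p \<alpha>) + fs.dim (kos_cycles N (Suc p) \<alpha>)"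
  using rank_nullity[OF lin_bd subspace_kos[OF assms] fin_supp_kos[OF assms], of "Suc p" \<alpha>]
  by (simp add: kos_bounds_def kos_cycles_def)

lemma kos_cycles_0: "kos_cycles N 0 \<alpha> = kos N 0 \<alpha>"
  using bd_kos_0 by (auto simp: kos_cycles_def)

text \<open>With both inclusions of cycles, the boundaries over \<open>N1\<close> and
  \<open>N2\<close> meet exactly in the cycles over \<open>N3\<close>, while their sum is the space
  of boundaries over \<open>N4\<close>. This determines all dimensions of chains and boundaries;
  those of cycles follow by rank-nullity.\<close>

lemma kos_dim_splitting:
  fixes N1 N2 N3 N4 :: "('n::finite \<Rightarrow> int) \<Rightarrow> (nat \<Rightarrow> 'k::field) set"
  assumes N1: "graded_module m N1" and N2: "graded_module m N2"
    and N3: "graded_module m N3" and N4: "graded_module m N4"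
    and Int: "\<And>\<beta>. N3 \<beta> = N1 \<beta> \<inter> N2 \<beta>" and Sum: "\<And>\<beta>. N4 \<beta> = {x + y |x y. x \<in> N1 \<beta> \<and> y \<in> N2 \<beta>}"
    and null1: "\<And>p. kos_cycles N3 p \<alpha> \<subseteq> kos_bounds N1 p \<alpha>"
    and null2: "\<And>p. kos_cycles N3 p \<alpha> \<subseteq> kos_bounds N2 p \<alpha>"
  shows "kos_dim N4 p \<alpha> = kos_dim N1 p \<alpha> + kos_dim N2 p \<alpha> + (if p = 0 then 0 else kos_dim N3 (p - 1) \<alpha>)"
proof -
  have kI: "kos N1 p \<alpha> \<inter> kos N2 p \<alpha> = kos N3 p \<alpha>" for p
    by (auto simp: kos_def Int)
  have kS: "{x + y |x y. x \<in> kos N1 p \<alpha> \<and> y \<in> kos N2 p \<alpha>} = kos N4 p \<alpha>" for p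
  proof
    show "{x + y |x y. x \<in> kos N1 p \<alpha> \<and> y \<in> kos N2 p \<alpha>} \<subseteq> kos N4 p \<alpha>"
    proof clarify
      fix x y assume x: "x \<in> kos N1 p \<alpha>" and y: "y \<in> kos N2 p \<alpha>"
      have "(\<lambda>j. (x + y) (\<sigma>, j)) \<in> N4 (shift \<alpha> \<sigma>)" for \<sigma>
      proof -
        have "(\<lambda>j. (x + y) (\<sigma>, j)) = (\<lambda>j. x (\<sigma>, j)) + (\<lambda>j. y (\<sigma>, j))" by auto
        then show ?thesis using x y unfolding Sum kos_def by blast
      qed
      then show "x + y \<in> kos N4 p \<alpha>" using x y by (auto simp: kos_def)
    qed
    show "kos N4 p \<alpha> \<subseteq> {x + y |x y. x \<in> kos N1 p \<alpha> \<and> y \<in> kos N2 p \<alpha>}"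
    proof
      fix t assume t: "t \<in> kos N4 p \<alpha>"
      \<comment> \<open>A chain over the sum is split set by set; both summands are taken to be 0
        off sets of size \<open>p\<close>, so that each half is again a chain of degree
        \<open>p\<close>.\<close>
      have "\<exists>z. fst z \<in> N1 (shift \<alpha> \<sigma>) \<and> snd z \<in> N2 (shift \<alpha> \<sigma>) \<and> (\<lambda>j. t (\<sigma>, j)) = fst z + snd z \<and>
        (card \<sigma> \<noteq> p \<longrightarrow> z = (0, 0))" for \<sigma>
      proof (cases "card \<sigma> = p")
        case True
        have "(\<lambda>j. t (\<sigma>, j)) \<in> N4 (shift \<alpha> \<sigma>)" using t by (simp add: kos_def)
        then obtain x y where "x \<in> N1 (shift \<alpha> \<sigma>)" "y \<in> N2 (shift \<alpha> \<sigma>)" "(\<lambda>j. t (\<sigma>, j)) = x + y"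
          unfolding Sum by blast
        then show ?thesis using True by (intro exI[of _ "(x, y)"]) simp
      next
        case False
        moreover have "(\<lambda>j. t (\<sigma>, j)) = 0 + 0" using False t by (auto simp: kos_def)
        moreover have "0 \<in> N1 (shift \<alpha> \<sigma>)" "0 \<in> N2 (shift \<alpha> \<sigma>)"
          using N1 N2 by (auto simp: graded_module_def subspace_iff)
        ultimately show ?thesis by (intro exI[of _ "(0, 0)"]) simp
      qed
      from choice[OF allI[OF this]] obtain z
        where z: "\<forall>\<sigma>. fst (z \<sigma>) \<in> N1 (shift \<alpha> \<sigma>) \<and> snd (z \<sigma>) \<in> N2 (shift \<alpha> \<sigma>) \<and>
          (\<lambda>j. t (\<sigma>, j)) = fst (z \<sigma>) + snd (z \<sigma>) \<and> (card \<sigma> \<noteq> p \<longrightarrow> z \<sigma> = (0, 0))" ..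
      define x y where "x = fst \<circ> z" and "y = snd \<circ> z"
      have xy: "x \<sigma> \<in> N1 (shift \<alpha> \<sigma>)" "y \<sigma> \<in> N2 (shift \<alpha> \<sigma>)"
        "(\<lambda>j. t (\<sigma>, j)) = x \<sigma> + y \<sigma>" "card \<sigma> \<noteq> p \<Longrightarrow> x \<sigma> = 0 \<and> y \<sigma> = 0" for \<sigma>
        using z[rule_format, of \<sigma>] by (auto simp: x_def y_def)
      have "(\<lambda>(\<sigma>, j). x \<sigma> j) \<in> kos N1 p \<alpha>" "(\<lambda>(\<sigma>, j). y \<sigma> j) \<in> kos N2 p \<alpha>"
        using xy(1,2,4) by (auto simp: kos_def)
      moreover have "t = (\<lambda>(\<sigma>, j). x \<sigma> j) + (\<lambda>(\<sigma>, j). y \<sigma> j)"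
        using xy(3) by (auto simp: fun_eq_iff)
      ultimately show "t \<in> {x + y |x y. x \<in> kos N1 p \<alpha> \<and> y \<in> kos N2 p \<alpha>}" by blast
    qed
  qed
  have bI: "kos_bounds N1 p \<alpha> \<inter> kos_bounds N2 p \<alpha> = kos_cycles N3 p \<alpha>" for p
  proof
    show "kos_cycles N3 p \<alpha> \<subseteq> kos_bounds N1 p \<alpha> \<inter> kos_bounds N2 p \<alpha>" using null1 null2 by blast
    show "kos_bounds N1 p \<alpha> \<inter> kos_bounds N2 p \<alpha> \<subseteq> kos_cycles N3 p \<alpha>"
      using kos_bounds_subset_cycles[OF N1, of p \<alpha>] kos_bounds_subset_cycles[OF N2, of p \<alpha>] kI[of p]
      by (auto simp: kos_cycles_def)
  qed
  have bS: "{x + y |x y. x \<in> kos_bounds N1 p \<alpha> \<and> y \<in> kos_bounds N2 p \<alpha>} = kos_bounds N4 p \<alpha>" for p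
  proof -
    have "bd (x + y) = bd x + bd y" for x y :: "'n set \<times> nat \<Rightarrow> 'k" using lin_bd unfolding lin_iff by blast
    then show ?thesis unfolding kos_bounds_def kS[of "Suc p", symmetric]
      by (auto simp: image_iff) metis+
  qed
  have 1: "fs.dim (kos N4 p \<alpha>) + fs.dim (kos N3 p \<alpha>) = fs.dim (kos N1 p \<alpha>) + fs.dim (kos N2 p \<alpha>)" for p
    using dim_sum_Int[OF subspace_kos[OF N1] fin_supp_kos[OF N1] subspace_kos[OF N2] fin_supp_kos[OF N2], of p \<alpha> p \<alpha>]
    by (simp only: kI kS)
  have 2: "fs.dim (kos_bounds N4 p \<alpha>) + fs.dim (kos_cycles N3 p \<alpha>) = fs.dim (kos_bounds N1 p \<alpha>) + fs.dim (kos_bounds N2 p \<alpha>)" for p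
    using dim_sum_Int[OF subspace_kos_bounds[OF N1] fin_supp_kos_bounds[OF N1] subspace_kos_bounds[OF N2] fin_supp_kos_bounds[OF N2], of p \<alpha> p \<alpha>]
    by (simp only: bI bS)
  have "int (kos_dim N4 p \<alpha>) = int (kos_dim N1 p \<alpha>) + int (kos_dim N2 p \<alpha>) + (if p = 0 then 0 else int (kos_dim N3 (p - 1) \<alpha>))"
  \<comment> \<open>In degree 0 every chain is a cycle. Otherwise rank-nullity ties the cycles in
    degree \<open>p\<close> to the boundaries in degree \<open>p - 1\<close>, where the intersection
    contributes its cycles instead of its boundaries; this is the source of the shifted
    summand.\<close>
  proof (cases p)
    case 0
    then show ?thesis
      using 1[of 0] 2[of 0] unfolding int_kos_dim[OF N1] int_kos_dim[OF N2] int_kos_dim[OF N4]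
      by (simp add: kos_cycles_0)
  next
    case (Suc p')
    then show ?thesis
      using 1[of "Suc p'"] 2[of "Suc p'"] 2[of p']
        dim_kos_Suc[OF N1, of p' \<alpha>] dim_kos_Suc[OF N2, of p' \<alpha>] dim_kos_Suc[OF N3, of p' \<alpha>] dim_kos_Suc[OF N4, of p' \<alpha>]
      unfolding int_kos_dim[OF N1] int_kos_dim[OF N2] int_kos_dim[OF N3] int_kos_dim[OF N4]
      by simp
  qed
  then show ?thesis by (simp split: if_splits)
qed

section \<open>Tor as Koszul homology\<close>

text \<open>The degree \<open>\<beta>\<close> component of the free module with generators in
  degrees \<open>a j\<close>: generator \<open>j\<close> contributes one scalar, the coefficient of
  its only monomial multiple of degree \<open>\<beta>\<close>.\<close>

definition free_part :: "nat \<Rightarrow> (nat \<Rightarrow> 'n \<Rightarrow> int) \<Rightarrow> ('n \<Rightarrow> int) \<Rightarrow> (nat \<Rightarrow> 'k::field) set" where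
  "free_part m a \<beta> = {w. \<forall>j. w j \<noteq> 0 \<longrightarrow> j < m \<and> a j \<le> \<beta>}"

definition mat :: "nat \<Rightarrow> nat \<Rightarrow> (nat \<Rightarrow> nat \<Rightarrow> 'k::field) \<Rightarrow> (nat \<Rightarrow> 'k) \<Rightarrow> nat \<Rightarrow> 'k" where
  "mat m n c w = (\<lambda>k. if k < m then \<Sum>j<n. c k j * w j else 0)"

text \<open>A map of degree 0 between graded free modules has as entries \<open>c k j\<close> times
  the monomial with exponent \<open>b j - a k\<close>; the condition makes that exponent nonnegative
  for nonzero scalars. In every multidegree the map then acts by the same matrix
  \<open>mat\<close>.\<close>

definition graded_matrix ::
    "nat \<Rightarrow> nat \<Rightarrow> (nat \<Rightarrow> 'n \<Rightarrow> int) \<Rightarrow> (nat \<Rightarrow> 'n \<Rightarrow> int) \<Rightarrow> (nat \<Rightarrow> nat \<Rightarrow> 'k::field) \<Rightarrow> bool" where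
  "graded_matrix m n a b c \<longleftrightarrow> (\<forall>k<m. \<forall>j<n. c k j \<noteq> 0 \<longrightarrow> a k \<le> b j)"

lemma lin_mat: "lin (mat m n c)"
  by (auto simp: lin_iff mat_def fun_eq_iff algebra_simps sum.distrib sum_distrib_left)

lemma free_part_mono: "\<beta> \<le> \<gamma> \<Longrightarrow> free_part m a \<beta> \<subseteq> free_part m a \<gamma>"
  by (auto simp: free_part_def intro: order_trans)

lemma graded_module_free_part: "graded_module m (free_part m a)"
  unfolding graded_module_def
proof (intro conjI allI impI ballI)
  show "fs.subspace (free_part m a \<beta>)" for \<beta>
    unfolding subspace_iff free_part_def by (auto, (metis add_0)+)
  show "free_part m a \<beta> \<subseteq> free_part m a \<gamma>" if "\<beta> \<le> \<gamma>" for \<beta> \<gamma>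
    using that by (rule free_part_mono)
  show "w j = 0" if "w \<in> free_part m a \<beta>" "m \<le> j" for \<beta> w j
    using that by (auto simp: free_part_def)
qed

lemma mat_free_part:
  assumes "graded_matrix m n a b c" "w \<in> free_part n b \<beta>"
  shows "mat m n c w \<in> free_part m a \<beta>"
  unfolding free_part_def
proof (intro CollectI allI impI)
  fix k assume k: "mat m n c w k \<noteq> 0"
  then have "k < m" "(\<Sum>j<n. c k j * w j) \<noteq> 0" by (auto simp: mat_def split: if_splits)
  then obtain j where "j < n" "c k j \<noteq> 0" "w j \<noteq> 0"
    by (metis (no_types, lifting) lessThan_iff mult_zero_left mult_zero_right sum.neutral)
  then have "a k \<le> b j" "b j \<le> \<beta>" using assms \<open>k < m\<close> by (auto simp: graded_matrix_def free_part_def)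
  then show "k < m \<and> a k \<le> \<beta>" using \<open>k < m\<close> by simp
qed

text \<open>
  The apex of the cone depends on the generator: any variable in which its degree lies strictly
  below \<open>\<alpha>\<close> will do. Only generators of degree \<open>\<alpha>\<close> have none, and they occur only at \<open>\<sigma> = {}\<close>.
\<close>

lemma kos_free_part_bd_eq:
  fixes t :: "'n::finite set \<times> nat \<Rightarrow> 'k::field"
  assumes t: "t \<in> kos (free_part m a) p \<alpha>" "bd t = 0" and 0: "\<And>j. a j = \<alpha> \<Longrightarrow> t ({}, j) = 0"
  shows "t \<in> bd ` kos (free_part m a) (Suc p) \<alpha>"
proof -
  define v :: "nat \<Rightarrow> 'n" where "v j = (SOME l. a j l < \<alpha> l)" for j
  have v: "j < m \<and> a j \<le> shift \<alpha> \<sigma> \<and> a j (v j) < \<alpha> (v j)" if "t (\<sigma>, j) \<noteq> 0" for \<sigma> j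
  proof -
    have j: "j < m" "a j \<le> shift \<alpha> \<sigma>" using t(1) that by (auto simp: kos_def free_part_def)
    have "a j \<noteq> \<alpha>"
    proof (cases "\<sigma> = {}")
      case False
      then obtain l where "l \<in> \<sigma>" by auto
      then have "a j l < \<alpha> l" using le_funD[OF j(2), of l] by (simp add: shift_def)
      then show ?thesis by auto
    qed (use 0 that in auto)
    moreover have "a j \<le> \<alpha>" using j(2) shift_antimono[of "{}" \<sigma> \<alpha>] by simp
    ultimately have "\<exists>l. a j l < \<alpha> l" by (metis antisym le_funI linorder_not_less)
    then have "a j (v j) < \<alpha> (v j)" unfolding v_def by (rule someI_ex)
    then show ?thesis using j by simp
  qed
  have "cone v t \<in> kos (free_part m a) (Suc p) \<alpha>"
    unfolding kos_def
  proof (intro CollectI allI conjI impI)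
    fix \<sigma>
    show "(\<lambda>j. cone v t (\<sigma>, j)) \<in> free_part m a (shift \<alpha> \<sigma>)"
      unfolding free_part_def
    proof (intro CollectI allI impI)
      fix j assume "cone v t (\<sigma>, j) \<noteq> 0"
      then have "v j \<in> \<sigma>" "t (\<sigma> - {v j}, j) \<noteq> 0" by (auto simp: cone_def split: if_splits)
      then have *: "j < m" "a j \<le> shift \<alpha> (\<sigma> - {v j})" "a j (v j) < \<alpha> (v j)" using v by blast+
      \<comment> \<open>At the apex the strict inequality leaves room to subtract 1 more; elsewhere
        the two shifts agree.\<close>
      have "a j l \<le> shift \<alpha> \<sigma> l" for l
        using le_funD[OF *(2), of l] *(3) by (cases "l = v j") (auto simp: shift_def)
      then show "j < m \<and> a j \<le> shift \<alpha> \<sigma>" using *(1) by (simp add: le_fun_def)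
    qed
    fix j assume "card \<sigma> \<noteq> Suc p"
    then have "t (\<sigma> - {v j}, j) = 0" if "v j \<in> \<sigma>"
      using t(1) that by (simp add: kos_def) (metis card.remove finite)
    then show "cone v t (\<sigma>, j) = 0" by (simp add: cone_def)
  qed
  then show ?thesis using bd_cone[OF t(2), of v] by (metis image_eqI)
qed

text \<open>A generator of degree \<open>\<alpha>\<close> cannot occur at a nonempty set, since the
  degree left there is too small. So these generators survive in Koszul degree 0 and account for all
  the homology of a free module.\<close>

lemma bd_kos_free_part_top:
  assumes "t \<in> kos (free_part m a) p \<alpha>" "a j = \<alpha>"
  shows "bd t ({}, j) = 0"
proof -
  have "t ({l}, j) = 0" for l
  proof (rule ccontr)
    assume "t ({l}, j) \<noteq> 0"
    then have "a j \<le> shift \<alpha> {l}" using assms(1) by (auto simp: kos_def free_part_def)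
    then have "a j l \<le> shift \<alpha> {l} l" by (rule le_funD)
    then show False using assms(2) by (simp add: shift_def)
  qed
  then show ?thesis by (simp add: bd_apply)
qed

definition coords :: "((nat \<Rightarrow> 'k) \<Rightarrow> nat \<Rightarrow> 'k) \<Rightarrow> ('n set \<times> nat \<Rightarrow> 'k::field) \<Rightarrow> 'n set \<times> nat \<Rightarrow> 'k" where
  "coords f t = (\<lambda>(\<sigma>, j). f (\<lambda>j. t (\<sigma>, j)) j)"

lemma coords_apply: "coords f t (\<sigma>, j) = f (\<lambda>j. t (\<sigma>, j)) j"
  by (simp add: coords_def)

lemma lin_coords:
  assumes "lin f"
  shows "lin (coords f)"
  using assms unfolding lin_iff coords_def by (simp add: fun_eq_iff plus_fun_def)

lemma lin_sum_pointwise: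
  assumes f: "lin f"
  shows "f (\<lambda>j. \<Sum>l\<in>A. c l * g l j) = (\<lambda>j. \<Sum>l\<in>A. c l * f (g l) j)"
proof (induction A rule: infinite_finite_induct)
  case (insert x F)
  have "f (\<lambda>j. \<Sum>l\<in>insert x F. c l * g l j) = f ((\<lambda>j. c x * g x j) + (\<lambda>j. \<Sum>l\<in>F. c l * g l j))"
    using insert by (simp add: plus_fun_def)
  also have "\<dots> = (\<lambda>j. c x * f (g x) j) + f (\<lambda>j. \<Sum>l\<in>F. c l * g l j)"
    using f unfolding lin_iff by simp
  finally show ?case using insert by (simp add: plus_fun_def)
qed (use lin_zero[OF f] in \<open>simp_all add: zero_fun_def\<close>)

lemma lin_compose: "lin f \<Longrightarrow> lin g \<Longrightarrow> lin (\<lambda>x. f (g x))"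
  unfolding lin_iff by simp

lemma coords_bd:
  assumes "lin f"
  shows "coords f (bd t) = bd (coords f t)"
proof
  fix z show "coords f (bd t) z = bd (coords f t) z"
    by (cases z) (simp add: coords_apply bd_apply lin_sum_pointwise[OF assms])
qed

lemma kos_coords:
  assumes "\<And>\<beta> w. w \<in> N \<beta> \<Longrightarrow> f w \<in> N' \<beta>" "lin f" "t \<in> kos N p \<alpha>"
  shows "coords f t \<in> kos N' p \<alpha>"
  unfolding kos_def
proof (intro CollectI allI conjI impI)
  fix \<sigma>
  show "(\<lambda>j. coords f t (\<sigma>, j)) \<in> N' (shift \<alpha> \<sigma>)"
    using assms(1,3) by (simp add: coords_apply kos_def)
  fix j assume "card \<sigma> \<noteq> p"
  then have "(\<lambda>j. t (\<sigma>, j)) = 0" using assms(3) by (auto simp: kos_def)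
  then show "coords f t (\<sigma>, j) = 0" using lin_zero[OF assms(2)] by (simp add: coords_apply)
qed

text \<open>Forming Koszul chains preserves surjections: a preimage is chosen for each set
  separately, and 0 where the size is not \<open>p\<close>.\<close>

lemma kos_coords_lift:
  fixes t :: "'n::finite set \<times> nat \<Rightarrow> 'k::field"
  assumes f: "lin f" and t: "t \<in> kos (\<lambda>\<beta>. f ` N \<beta>) p \<alpha>" and N: "graded_module m N"
  shows "t \<in> coords f ` kos N p \<alpha>"
proof -
  have "\<exists>w. w \<in> N (shift \<alpha> \<sigma>) \<and> (\<lambda>j. t (\<sigma>, j)) = f w \<and> (card \<sigma> \<noteq> p \<longrightarrow> w = 0)" for \<sigma>
  proof (cases "card \<sigma> = p")
    case True
    have "(\<lambda>j. t (\<sigma>, j)) \<in> f ` N (shift \<alpha> \<sigma>)" using t by (simp add: kos_def)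
    then show ?thesis using True by blast
  next
    case False
    then have "(\<lambda>j. t (\<sigma>, j)) = 0" using t by (auto simp: kos_def)
    moreover have "0 \<in> N (shift \<alpha> \<sigma>)" using N by (simp add: graded_module_def subspace_iff)
    ultimately show ?thesis using lin_zero[OF f] by (intro exI[of _ 0]) simp
  qed
  from choice[OF allI[OF this]] obtain w where w:
    "\<forall>\<sigma>. w \<sigma> \<in> N (shift \<alpha> \<sigma>) \<and> (\<lambda>j. t (\<sigma>, j)) = f (w \<sigma>) \<and> (card \<sigma> \<noteq> p \<longrightarrow> w \<sigma> = 0)" ..
  have "(\<lambda>(\<sigma>, j). w \<sigma> j) \<in> kos N p \<alpha>" using w by (auto simp: kos_def)
  moreover have "t = coords f (\<lambda>(\<sigma>, j). w \<sigma> j)"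
    using w by (auto simp: coords_def fun_eq_iff)
  ultimately show ?thesis by blast
qed

text \<open>Exactness is required in each multidegree at every step except \<open>0\<close>, so the
  complex resolves the image \<open>syz 0\<close> of the map into step \<open>0\<close>.\<close>

locale graded_resolution =
  fixes r :: "nat \<Rightarrow> nat" and a :: "nat \<Rightarrow> nat \<Rightarrow> 'n::finite \<Rightarrow> int" and c :: "nat \<Rightarrow> nat \<Rightarrow> nat \<Rightarrow> 'k::field"
  assumes graded: "graded_matrix (r q) (r (Suc q)) (a q) (a (Suc q)) (c q)"
    and exact: "{w\<in>free_part (r (Suc q)) (a (Suc q)) \<beta>. mat (r q) (r (Suc q)) (c q) w = 0} =
      mat (r (Suc q)) (r (Suc (Suc q))) (c (Suc q)) ` free_part (r (Suc (Suc q))) (a (Suc (Suc q))) \<beta>"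
begin

abbreviation L where "L q \<equiv> free_part (r q) (a q) :: ('n \<Rightarrow> int) \<Rightarrow> (nat \<Rightarrow> 'k) set"
abbreviation D where "D q \<equiv> mat (r q) (r (Suc q)) (c q)"
abbreviation Dc where "Dc q \<equiv> coords (D q) :: ('n set \<times> nat \<Rightarrow> 'k) \<Rightarrow> ('n set \<times> nat \<Rightarrow> 'k)"

section \<open>Syzygies and dimension shifting\<close>

definition syz :: "nat \<Rightarrow> ('n \<Rightarrow> int) \<Rightarrow> (nat \<Rightarrow> 'k) set" where
  "syz q \<beta> = D q ` L (Suc q) \<beta>"

lemma syz_Suc: "syz (Suc q) \<beta> = {w\<in>L (Suc q) \<beta>. D q w = 0}"
  unfolding syz_def exact ..

lemma gm_L: "graded_module (r q) (L q)"
  by (rule graded_module_free_part)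

lemma bd_L: "t \<in> kos (L q) (Suc p) \<alpha> \<Longrightarrow> bd t \<in> kos (L q) p \<alpha>"
  by (rule bd_kos[OF gm_L])

lemma gm_syz: "graded_module (r q) (syz q)"
  unfolding graded_module_def
proof (intro conjI allI impI ballI)
  show "fs.subspace (syz q \<beta>)" for \<beta>
    unfolding syz_def using gm_L[of "Suc q"]
    by (intro subspace_image[OF lin_mat]) (simp add: graded_module_def)
  show "syz q \<beta> \<subseteq> syz q \<gamma>" if "\<beta> \<le> \<gamma>" for \<beta> \<gamma>
    unfolding syz_def using free_part_mono[OF that] by (rule image_mono)
  show "w j = 0" if "w \<in> syz q \<beta>" "r q \<le> j" for \<beta> w j
    using that by (auto simp: syz_def mat_def)
qed

lemma kos_syz_Suc: "kos (syz (Suc q)) p \<alpha> = {t\<in>kos (L (Suc q)) p \<alpha>. Dc q t = 0}"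
proof -
  have "Dc q t = 0 \<longleftrightarrow> (\<forall>\<sigma>. D q (\<lambda>j. t (\<sigma>, j)) = 0)" for t :: "'n set \<times> nat \<Rightarrow> 'k"
    by (auto simp: coords_def fun_eq_iff)
  then show ?thesis by (auto simp: kos_def syz_Suc)
qed

lemma kos_syz_image: "kos (syz q) p \<alpha> = Dc q ` kos (L (Suc q)) p \<alpha>"
proof
  show "kos (syz q) p \<alpha> \<subseteq> Dc q ` kos (L (Suc q)) p \<alpha>"
    using kos_coords_lift[OF lin_mat _ gm_L] unfolding syz_def by fast
  show "Dc q ` kos (L (Suc q)) p \<alpha> \<subseteq> kos (syz q) p \<alpha>"
    by (intro image_subsetI kos_coords[where N = "L (Suc q)", OF _ lin_mat]) (auto simp: syz_def)
qed

lemma lin_Dc: "lin (Dc q)"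
  by (rule lin_coords[OF lin_mat])

lemma Dc_bd: "Dc q (bd t) = bd (Dc q t)"
  by (rule coords_bd[OF lin_mat])

text \<open>Modulo boundaries over \<open>syz (Suc q)\<close>, this is the kernel of the map on
  Koszul homology from \<open>syz (Suc q)\<close> to \<open>L (Suc q)\<close>, hence the image of
  the connecting map.\<close>

definition exact_cycles :: "nat \<Rightarrow> nat \<Rightarrow> ('n \<Rightarrow> int) \<Rightarrow> ('n set \<times> nat \<Rightarrow> 'k) set" where
  "exact_cycles q p \<alpha> = kos (syz (Suc q)) p \<alpha> \<inter> bd ` kos (L (Suc q)) (Suc p) \<alpha>"

lemma kos_diff: "graded_module m N \<Longrightarrow> x \<in> kos N p \<alpha> \<Longrightarrow> y \<in> kos N p \<alpha> \<Longrightarrow> x - y \<in> kos N p \<alpha>"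
  using fs.subspace_diff[OF subspace_kos] by blast

text \<open>
  The zigzag \<open>D q t \<leftarrow> t \<rightarrow> bd t\<close> is the connecting map of \<open>0 \<rightarrow> syz (q + 1) \<rightarrow> L (q + 1) \<rightarrow> syz q \<rightarrow> 0\<close>, which
  is injective because the Koszul homology of a free module is concentrated in degree \<open>0\<close>.
\<close>

lemma connecting:
  "int (kos_dim (syz q) (Suc p) \<alpha>) =
    int (fs.dim (exact_cycles q p \<alpha>)) - int (fs.dim (kos_bounds (syz (Suc q)) p \<alpha>))"
proof -
  \<comment> \<open>\<open>Z\<close> holds the middle terms of all zigzags. It maps onto the cycles
    by \<open>Dc q\<close> and onto \<open>exact_cycles\<close> by \<open>bd\<close>, and
    \<open>Z0\<close> turns out to be the preimage of the boundaries under either map, so the two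
    quotients have equal dimension.\<close>
  define Z where "Z = {t\<in>kos (L (Suc q)) (Suc p) \<alpha>. bd (Dc q t) = 0}"
  define Z0 where "Z0 = {t\<in>Z. Dc q t \<in> kos_bounds (syz q) (Suc p) \<alpha>}"
  have linbD: "lin (\<lambda>t. bd (Dc q t))"
    by (rule lin_compose[OF lin_bd lin_Dc])
  have Z: "fs.subspace Z" unfolding Z_def by (rule subspace_kernel[OF linbD subspace_kos[OF gm_L]])
  have fZ: "fin_supp Z" by (rule fin_supp_subset[OF fin_supp_kos[OF gm_L]]) (auto simp: Z_def)
  have Z0: "fs.subspace Z0"
    unfolding Z0_def by (rule subspace_preimage[OF lin_Dc Z subspace_kos_bounds[OF gm_syz]])
  have Z0Z: "Z0 \<subseteq> Z" by (auto simp: Z0_def)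
  have imD: "Dc q ` Z = kos_cycles (syz q) (Suc p) \<alpha>"
    unfolding Z_def kos_cycles_def kos_syz_image by auto
  have imb: "bd ` Z = exact_cycles q p \<alpha>"
  proof
    show "bd ` Z \<subseteq> exact_cycles q p \<alpha>"
      using bd_kos[OF gm_L] by (auto simp: Z_def exact_cycles_def kos_syz_Suc Dc_bd)
    show "exact_cycles q p \<alpha> \<subseteq> bd ` Z"
      by (auto simp: Z_def exact_cycles_def kos_syz_Suc Dc_bd)
  qed
  have pre: "t \<in> Z0 \<longleftrightarrow> bd t \<in> kos_bounds (syz (Suc q)) p \<alpha>" if t: "t \<in> Z" for t
  proof
    assume "t \<in> Z0"
    then obtain u where u: "u \<in> kos (L (Suc q)) (Suc (Suc p)) \<alpha>" "Dc q t = bd (Dc q u)"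
      unfolding Z0_def kos_bounds_def kos_syz_image by auto
    have "Dc q (t - bd u) = 0" using u(2) by (simp add: lin_diff[OF lin_Dc] Dc_bd)
    moreover have "t - bd u \<in> kos (L (Suc q)) (Suc p) \<alpha>"
      using t u(1) bd_L kos_diff[OF gm_L] by (auto simp: Z_def)
    ultimately have "t - bd u \<in> kos (syz (Suc q)) (Suc p) \<alpha>" by (simp add: kos_syz_Suc)
    moreover have "bd t = bd (t - bd u)" by (simp add: lin_diff[OF lin_bd] bd_bd)
    ultimately show "bd t \<in> kos_bounds (syz (Suc q)) p \<alpha>" unfolding kos_bounds_def by blast
  next
    assume "bd t \<in> kos_bounds (syz (Suc q)) p \<alpha>"
    then obtain u where u: "u \<in> kos (L (Suc q)) (Suc p) \<alpha>" "Dc q u = 0" "bd t = bd u"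
      unfolding kos_bounds_def kos_syz_Suc by auto
    have "t - u \<in> kos (L (Suc q)) (Suc p) \<alpha>" using t u(1) kos_diff[OF gm_L] by (auto simp: Z_def)
    moreover have "bd (t - u) = 0" using u(3) by (simp add: lin_diff[OF lin_bd])
    \<comment> \<open>The chain has positive Koszul degree, so it vanishes at the empty set and the
      generators of degree \<open>\<alpha>\<close> cannot obstruct bounding.\<close>
    moreover have "(t - u) ({}, j) = 0" for j using calculation(1) by (simp add: kos_def)
    ultimately obtain s where s: "s \<in> kos (L (Suc q)) (Suc (Suc p)) \<alpha>" "t - u = bd s"
      using kos_free_part_bd_eq by blast
    have "Dc q t = Dc q (t - u)" using u(2) by (simp add: lin_diff[OF lin_Dc])
    also have "\<dots> = bd (Dc q s)" by (simp add: s(2) Dc_bd)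
    finally show "t \<in> Z0" using t s(1) unfolding Z0_def kos_bounds_def kos_syz_image by blast
  qed
  have "int (fs.dim Z) - int (fs.dim Z0) =
      int (fs.dim (kos_cycles (syz q) (Suc p) \<alpha>)) - int (fs.dim (kos_bounds (syz q) (Suc p) \<alpha>))"
    using kos_bounds_subset_cycles[OF gm_syz] imD subspace_kos_bounds[OF gm_syz, of q "Suc p" \<alpha>]
    by (intro dim_quotient[OF lin_Dc Z fZ Z0 Z0Z]) (auto simp: Z0_def subspace_iff)
  moreover have "int (fs.dim Z) - int (fs.dim Z0) =
      int (fs.dim (exact_cycles q p \<alpha>)) - int (fs.dim (kos_bounds (syz (Suc q)) p \<alpha>))"
  proof (rule dim_quotient[OF lin_bd Z fZ Z0 Z0Z _ imb pre])
    show "kos_bounds (syz (Suc q)) p \<alpha> \<subseteq> exact_cycles q p \<alpha>"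
      using kos_bounds_subset_cycles[OF gm_syz] by (fastforce simp: kos_bounds_def exact_cycles_def kos_cycles_def kos_syz_Suc)
    show "0 \<in> kos_bounds (syz (Suc q)) p \<alpha>"
      using subspace_kos_bounds[OF gm_syz] by (simp add: subspace_iff)
  qed
  ultimately show ?thesis by (simp add: int_kos_dim[OF gm_syz])
qed

lemma exact_cycles_Suc: "exact_cycles q (Suc p) \<alpha> = kos_cycles (syz (Suc q)) (Suc p) \<alpha>"
proof
  show "exact_cycles q (Suc p) \<alpha> \<subseteq> kos_cycles (syz (Suc q)) (Suc p) \<alpha>"
    by (auto simp: exact_cycles_def kos_cycles_def bd_bd)
  show "kos_cycles (syz (Suc q)) (Suc p) \<alpha> \<subseteq> exact_cycles q (Suc p) \<alpha>"
  proof
    fix t assume t: "t \<in> kos_cycles (syz (Suc q)) (Suc p) \<alpha>"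
    then have "t ({}, j) = 0" for j by (simp add: kos_cycles_def kos_def)
    then have "t \<in> bd ` kos (L (Suc q)) (Suc (Suc p)) \<alpha>"
      using t by (intro kos_free_part_bd_eq) (auto simp: kos_cycles_def kos_syz_Suc)
    then show "t \<in> exact_cycles q (Suc p) \<alpha>"
      using t by (simp add: exact_cycles_def kos_cycles_def)
  qed
qed

lemma dimension_shift: "kos_dim (syz q) (Suc (Suc p)) \<alpha> = kos_dim (syz (Suc q)) (Suc p) \<alpha>"
  using connecting[of q "Suc p" \<alpha>] int_kos_dim[OF gm_syz, of "Suc q" "Suc p" \<alpha>]
  by (simp add: exact_cycles_Suc)

text \<open>Each shift trades one Koszul degree for one syzygy. It stops at Koszul degree 1: one
  degree lower, \<open>exact_cycles\<close> may be smaller than the space of cycles, because a free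
  module has homology in degree 0.\<close>

lemma kos_dim_syz: "kos_dim (syz q) (Suc p) \<alpha> = kos_dim (syz (q + p)) 1 \<alpha>"
  by (induction p arbitrary: q) (simp_all add: dimension_shift)

text \<open>The degree \<open>\<alpha>\<close> part of K \<otimes> L q, which is also the degree 0
  Koszul homology of \<open>L q\<close>. Below, \<open>top_map\<close> is the tensored differential,
  \<open>top_part\<close> the reduction modulo the variables and \<open>embed\<close> a section of
  it.\<close>

definition top_space :: "nat \<Rightarrow> ('n \<Rightarrow> int) \<Rightarrow> (nat \<Rightarrow> 'k) set" where
  "top_space q \<alpha> = {w. \<forall>j. w j \<noteq> 0 \<longrightarrow> j < r q \<and> a q j = \<alpha>}"

definition top_map :: "nat \<Rightarrow> ('n \<Rightarrow> int) \<Rightarrow> (nat \<Rightarrow> 'k) \<Rightarrow> nat \<Rightarrow> 'k" where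
  "top_map q \<alpha> w = (\<lambda>k. if k < r q \<and> a q k = \<alpha>
     then \<Sum>j | j < r (Suc q) \<and> a (Suc q) j = \<alpha>. c q k j * w j else 0)"

definition top_part :: "nat \<Rightarrow> ('n \<Rightarrow> int) \<Rightarrow> ('n set \<times> nat \<Rightarrow> 'k) \<Rightarrow> nat \<Rightarrow> 'k" where
  "top_part q \<alpha> u = (\<lambda>j. if j < r q \<and> a q j = \<alpha> then u ({}, j) else 0)"

definition embed :: "(nat \<Rightarrow> 'k) \<Rightarrow> 'n set \<times> nat \<Rightarrow> 'k" where
  "embed w = (\<lambda>(\<sigma>, j). if \<sigma> = {} then w j else 0)"

lemma lin_top_part: "lin (top_part q \<alpha>)"
  by (auto simp: lin_iff top_part_def fun_eq_iff)

lemma lin_top_map: "lin (top_map q \<alpha>)"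
  by (auto simp: lin_iff top_map_def fun_eq_iff algebra_simps sum.distrib sum_distrib_left)

lemma subspace_top_space: "fs.subspace (top_space q \<alpha>)"
  unfolding subspace_iff top_space_def by (auto, (metis add_0)+)

lemma embed: "w \<in> top_space q \<alpha> \<Longrightarrow> embed w \<in> kos (L q) 0 \<alpha>"
  by (auto simp: kos_def free_part_def top_space_def embed_def)

lemma top_part_embed: "w \<in> top_space q \<alpha> \<Longrightarrow> top_part q \<alpha> (embed w) = w"
  by (auto simp: top_space_def embed_def top_part_def fun_eq_iff)

lemma top_part_in: "top_part q \<alpha> u \<in> top_space q \<alpha>"
  by (auto simp: top_space_def top_part_def)

text \<open>In a row of degree \<open>\<alpha>\<close>, a nonzero entry forces the column degree to
  be at least \<open>\<alpha>\<close>, and a nonzero coordinate of \<open>u\<close> forces it to be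
  at most \<open>\<alpha>\<close>; so only columns of degree \<open>\<alpha>\<close>
  contribute.\<close>

lemma top_part_Dc:
  assumes "u \<in> kos (L (Suc q)) 0 \<alpha>"
  shows "top_part q \<alpha> (Dc q u) = top_map q \<alpha> (top_part (Suc q) \<alpha> u)"
proof
  fix k
  show "top_part q \<alpha> (Dc q u) k = top_map q \<alpha> (top_part (Suc q) \<alpha> u) k"
  proof (cases "k < r q \<and> a q k = \<alpha>")
    case True
    have u: "u ({}, j) \<noteq> 0 \<Longrightarrow> a (Suc q) j \<le> \<alpha>" for j
    proof -
      have "(\<lambda>j. u ({}, j)) \<in> L (Suc q) (shift \<alpha> {})" using assms unfolding kos_def by blast
      then show "u ({}, j) \<noteq> 0 \<Longrightarrow> a (Suc q) j \<le> \<alpha>" by (auto simp: free_part_def)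
    qed
    have c: "c q k j \<noteq> 0 \<Longrightarrow> j < r (Suc q) \<Longrightarrow> \<alpha> \<le> a (Suc q) j" for j
      using graded[of q] True by (auto simp: graded_matrix_def)
    have "(\<Sum>j<r (Suc q). c q k j * u ({}, j)) =
        (\<Sum>j | j < r (Suc q) \<and> a (Suc q) j = \<alpha>. c q k j * u ({}, j))"
    proof (rule sum.mono_neutral_right)
      show "\<forall>j\<in>{..<r (Suc q)} - {j. j < r (Suc q) \<and> a (Suc q) j = \<alpha>}. c q k j * u ({}, j) = 0"
        using u c by (fastforce intro: antisym)
    qed auto
    also have "\<dots> = (\<Sum>j | j < r (Suc q) \<and> a (Suc q) j = \<alpha>. c q k j * top_part (Suc q) \<alpha> u j)"
      by (intro sum.cong refl) (simp add: top_part_def)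
    finally show ?thesis using True by (simp add: top_part_def top_map_def coords_apply mat_def)
  qed (auto simp: top_part_def top_map_def)
qed

lemma top_part_bd:
  assumes "s \<in> kos (L q) p \<alpha>"
  shows "top_part q \<alpha> (bd s) = 0"
  using bd_kos_free_part_top[OF assms] by (auto simp: top_part_def fun_eq_iff)

lemma bd_eqI_top:
  assumes u: "u \<in> kos (L q) 0 \<alpha>" and 0: "top_part q \<alpha> u = 0"
  shows "u \<in> bd ` kos (L q) 1 \<alpha>"
proof -
  have "u ({}, j) = 0" if "a q j = \<alpha>" for j
  proof (cases "j < r q")
    case True
    then show ?thesis using fun_cong[OF 0, of j] that by (simp add: top_part_def)
  next
    case False
    have "(\<lambda>j. u ({}, j)) \<in> L q (shift \<alpha> {})" using u unfolding kos_def by blast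
    then show ?thesis using False by (auto simp: free_part_def)
  qed
  then show ?thesis using kos_free_part_bd_eq[OF u bd_kos_0[OF u]] by simp
qed

lemma Dc_Dc:
  assumes "v \<in> kos (L (Suc (Suc q))) p \<alpha>"
  shows "Dc q (Dc (Suc q) v) = 0"
proof -
  have "Dc (Suc q) v \<in> kos (syz (Suc q)) p \<alpha>" unfolding kos_syz_image using assms by simp
  then show ?thesis by (simp add: kos_syz_Suc)
qed

text \<open>Degree 0 chains with top part in \<open>T\<close> map onto \<open>T\<close> by
  \<open>top_part\<close> and onto the space on the right by \<open>Dc q\<close>, and the preimages
  of the two subspaces coincide. \<open>T\<close> is left open: it will be all of
  \<open>top_space\<close> for Tor in degree 0 and a kernel otherwise.\<close>

lemma top_homology:
  assumes T: "fs.subspace T" "T \<subseteq> top_space (Suc q) \<alpha>"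
    and B: "top_map (Suc q) \<alpha> ` top_space (Suc (Suc q)) \<alpha> \<subseteq> T"
  shows "int (fs.dim T) - int (fs.dim (top_map (Suc q) \<alpha> ` top_space (Suc (Suc q)) \<alpha>)) =
    int (fs.dim (Dc q ` {u\<in>kos (L (Suc q)) 0 \<alpha>. top_part (Suc q) \<alpha> u \<in> T})) - int (fs.dim (kos_bounds (syz q) 0 \<alpha>))"
proof -
  let ?B = "top_map (Suc q) \<alpha> ` top_space (Suc (Suc q)) \<alpha>"
  define Z where "Z = {u\<in>kos (L (Suc q)) 0 \<alpha>. top_part (Suc q) \<alpha> u \<in> T}"
  define Z0 where "Z0 = {u\<in>Z. top_part (Suc q) \<alpha> u \<in> ?B}"
  have B': "fs.subspace ?B" by (rule subspace_image[OF lin_top_map subspace_top_space])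
  have Z: "fs.subspace Z"
    unfolding Z_def by (rule subspace_preimage[OF lin_top_part subspace_kos[OF gm_L] T(1)])
  have fZ: "fin_supp Z" by (rule fin_supp_subset[OF fin_supp_kos[OF gm_L]]) (auto simp: Z_def)
  have Z0: "fs.subspace Z0"
    unfolding Z0_def by (rule subspace_preimage[OF lin_top_part Z B'])
  have Z0Z: "Z0 \<subseteq> Z" by (auto simp: Z0_def)
  have "top_part (Suc q) \<alpha> ` Z = T"
  proof
    show "T \<subseteq> top_part (Suc q) \<alpha> ` Z"
    proof
      fix w assume w: "w \<in> T"
      then have w': "w \<in> top_space (Suc q) \<alpha>" using T(2) by auto
      then have "embed w \<in> Z" using embed[OF w'] w by (simp add: Z_def top_part_embed)
      then show "w \<in> top_part (Suc q) \<alpha> ` Z" by (rule rev_image_eqI) (simp add: top_part_embed w')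
    qed
  qed (auto simp: Z_def)
  then have "int (fs.dim Z) - int (fs.dim Z0) = int (fs.dim T) - int (fs.dim ?B)"
    using B' by (intro dim_quotient[OF lin_top_part[of "Suc q" \<alpha>] Z fZ Z0 Z0Z B]) (auto simp: Z0_def subspace_iff)
  moreover have pre: "u \<in> Z0 \<longleftrightarrow> Dc q u \<in> kos_bounds (syz q) 0 \<alpha>" if u: "u \<in> Z" for u
  proof
    assume "u \<in> Z0"
    then obtain w where w: "w \<in> top_space (Suc (Suc q)) \<alpha>" "top_part (Suc q) \<alpha> u = top_map (Suc q) \<alpha> w"
      by (auto simp: Z0_def)
    \<comment> \<open>A lift of the tensored boundary: it has the same top part as \<open>u\<close>
      but dies under \<open>Dc q\<close>. Subtracting it turns \<open>u\<close> into a Koszul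
      boundary without changing \<open>Dc q u\<close>.\<close>
    let ?v = "Dc (Suc q) (embed w)"
    have e: "embed w \<in> kos (L (Suc (Suc q))) 0 \<alpha>" using w(1) by (rule embed)
    then have v: "?v \<in> kos (L (Suc q)) 0 \<alpha>"
      using kos_syz_image[of "Suc q"] by (auto simp: kos_syz_Suc)
    have "top_part (Suc q) \<alpha> (u - ?v) = 0"
      using w by (simp add: lin_diff[OF lin_top_part] top_part_Dc[OF e] top_part_embed)
    then obtain s where s: "s \<in> kos (L (Suc q)) 1 \<alpha>" "u - ?v = bd s"
      using bd_eqI_top[of "u - ?v" "Suc q" \<alpha>] kos_diff[OF gm_L _ v] u by (auto simp: Z_def)
    have "Dc q u = Dc q (u - ?v)" using Dc_Dc[OF e] by (simp add: lin_diff[OF lin_Dc])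
    also have "\<dots> = bd (Dc q s)" by (simp add: s(2) Dc_bd)
    finally show "Dc q u \<in> kos_bounds (syz q) 0 \<alpha>"
      using s(1) unfolding kos_bounds_def kos_syz_image by simp
  next
    assume "Dc q u \<in> kos_bounds (syz q) 0 \<alpha>"
    then obtain s where s: "s \<in> kos (L (Suc q)) 1 \<alpha>" "Dc q u = bd (Dc q s)"
      unfolding kos_bounds_def kos_syz_image by auto
    have "Dc q (u - bd s) = 0" using s(2) by (simp add: lin_diff[OF lin_Dc] Dc_bd)
    moreover have "u - bd s \<in> kos (L (Suc q)) 0 \<alpha>"
      using u s(1) bd_L kos_diff[OF gm_L] by (auto simp: Z_def)
    ultimately have "u - bd s \<in> kos (syz (Suc q)) 0 \<alpha>" by (simp add: kos_syz_Suc)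
    then obtain v where v: "v \<in> kos (L (Suc (Suc q))) 0 \<alpha>" "u - bd s = Dc (Suc q) v"
      unfolding kos_syz_image by auto
    have "top_part (Suc q) \<alpha> u = top_part (Suc q) \<alpha> (u - bd s)"
      by (simp add: lin_diff[OF lin_top_part] top_part_bd[OF s(1)])
    also have "\<dots> = top_map (Suc q) \<alpha> (top_part (Suc (Suc q)) \<alpha> v)"
      unfolding v(2) by (rule top_part_Dc[OF v(1)])
    finally show "u \<in> Z0" using u top_part_in unfolding Z0_def by auto
  qed
  moreover have "int (fs.dim Z) - int (fs.dim Z0) = int (fs.dim (Dc q ` Z)) - int (fs.dim (kos_bounds (syz q) 0 \<alpha>))"
  proof (rule dim_quotient[OF lin_Dc Z fZ Z0 Z0Z _ refl pre])
    show "0 \<in> kos_bounds (syz q) 0 \<alpha>"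
      using subspace_kos_bounds[OF gm_syz] by (simp add: subspace_iff)
    show "kos_bounds (syz q) 0 \<alpha> \<subseteq> Dc q ` Z"
    proof
      fix y assume y: "y \<in> kos_bounds (syz q) 0 \<alpha>"
      then obtain s where s: "s \<in> kos (L (Suc q)) 1 \<alpha>" "y = bd (Dc q s)"
        unfolding kos_bounds_def kos_syz_image by auto
      then have "bd s \<in> Z" using bd_kos[OF gm_L] T(1) by (simp add: Z_def top_part_bd subspace_iff)
      then show "y \<in> Dc q ` Z" by (rule rev_image_eqI) (simp add: s(2) Dc_bd)
    qed
  qed
  ultimately show ?thesis by (simp add: Z_def)
qed

lemma top_map_top_map:
  assumes "w \<in> top_space (Suc (Suc q)) \<alpha>"
  shows "top_map q \<alpha> (top_map (Suc q) \<alpha> w) = 0"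
proof -
  have e: "embed w \<in> kos (L (Suc (Suc q))) 0 \<alpha>" using assms by (rule embed)
  then have v: "Dc (Suc q) (embed w) \<in> kos (L (Suc q)) 0 \<alpha>"
    using kos_syz_image[of "Suc q"] by (auto simp: kos_syz_Suc)
  show ?thesis
    using top_part_Dc[OF v] top_part_Dc[OF e] Dc_Dc[OF e] lin_zero[OF lin_top_part]
    by (simp add: top_part_embed[OF assms])
qed

text \<open>Tor in degree \<open>i\<close> is located at step \<open>i + 1\<close>. For
  \<open>i = 0\<close> there is no condition, because the map into step \<open>0\<close> does not
  belong to the tensored complex.\<close>

fun top_cycles :: "nat \<Rightarrow> ('n \<Rightarrow> int) \<Rightarrow> (nat \<Rightarrow> 'k) set" where
  "top_cycles 0 \<alpha> = top_space 1 \<alpha>"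
| "top_cycles (Suc i) \<alpha> = {w\<in>top_space (Suc (Suc i)) \<alpha>. top_map (Suc i) \<alpha> w = 0}"

text \<open>For \<open>i = 0\<close> both sides are \<open>syz 0\<close> modulo the variables. For
  \<open>i = p + 1\<close> the left side is \<open>exact_cycles p 0\<close> modulo the boundaries
  over \<open>syz (Suc p)\<close>; by the connecting map this is the Koszul homology of
  \<open>syz p\<close> in degree 1, from where dimension shifting leads back to
  \<open>syz 0\<close>.\<close>

lemma top_homology_eq_kos_dim:
  "fs.dim (top_cycles i \<alpha>) - fs.dim (top_map (Suc i) \<alpha> ` top_space (Suc (Suc i)) \<alpha>) = kos_dim (syz 0) i \<alpha>"
proof (cases i)
  case 0
  have "{u\<in>kos (L (Suc 0)) 0 \<alpha>. top_part (Suc 0) \<alpha> u \<in> top_space (Suc 0) \<alpha>} = kos (L (Suc 0)) 0 \<alpha>"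
    using top_part_in by auto
  moreover have "top_map (Suc 0) \<alpha> ` top_space (Suc (Suc 0)) \<alpha> \<subseteq> top_space (Suc 0) \<alpha>"
    by (auto simp: top_map_def top_space_def)
  ultimately show ?thesis
    using top_homology[OF subspace_top_space order_refl, of 0 \<alpha>] int_kos_dim[OF gm_syz, of 0 0 \<alpha>] 0
    by (simp add: kos_cycles_0 kos_syz_image)
next
  case (Suc p)
  have T: "fs.subspace (top_cycles i \<alpha>)" "top_cycles i \<alpha> \<subseteq> top_space (Suc (Suc p)) \<alpha>"
    using subspace_kernel[OF lin_top_map subspace_top_space] by (auto simp: Suc)
  have B: "top_map (Suc (Suc p)) \<alpha> ` top_space (Suc (Suc (Suc p))) \<alpha> \<subseteq> top_cycles i \<alpha>"
    using top_map_top_map by (auto simp: Suc) (auto simp: top_map_def top_space_def)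
  have "Dc (Suc p) ` {u\<in>kos (L (Suc (Suc p))) 0 \<alpha>. top_part (Suc (Suc p)) \<alpha> u \<in> top_cycles i \<alpha>} = exact_cycles p 0 \<alpha>"
  proof -
    have "top_part (Suc (Suc p)) \<alpha> u \<in> top_cycles i \<alpha> \<longleftrightarrow> Dc (Suc p) u \<in> bd ` kos (L (Suc p)) 1 \<alpha>"
      if u: "u \<in> kos (L (Suc (Suc p))) 0 \<alpha>" for u
    proof -
      have D: "Dc (Suc p) u \<in> kos (L (Suc p)) 0 \<alpha>"
        using kos_syz_image[of "Suc p"] u by (auto simp: kos_syz_Suc)
      have "top_part (Suc (Suc p)) \<alpha> u \<in> top_cycles i \<alpha> \<longleftrightarrow> top_part (Suc p) \<alpha> (Dc (Suc p) u) = 0"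
        using top_part_in by (simp add: Suc top_part_Dc[OF u])
      also have "\<dots> \<longleftrightarrow> Dc (Suc p) u \<in> bd ` kos (L (Suc p)) 1 \<alpha>"
        using bd_eqI_top[OF D] top_part_bd by auto
      finally show ?thesis .
    qed
    then show ?thesis unfolding exact_cycles_def kos_syz_image by auto
  qed
  then have "int (fs.dim (top_cycles i \<alpha>)) - int (fs.dim (top_map (Suc i) \<alpha> ` top_space (Suc (Suc i)) \<alpha>)) =
      int (kos_dim (syz p) 1 \<alpha>)"
    using top_homology[OF T B] connecting[of p 0 \<alpha>] by (simp add: Suc)
  also have "\<dots> = int (kos_dim (syz 0) i \<alpha>)" using kos_dim_syz[of 0 p \<alpha>] by (simp add: Suc)
  finally show ?thesis by linarith
qed

end

section \<open>Polynomial matrices and their graded components\<close>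

definition expo :: "('n \<Rightarrow>\<^sub>0 nat) \<Rightarrow> 'n \<Rightarrow> int" where
  "expo m = (\<lambda>l. int (Poly_Mapping.lookup m l))"

text \<open>Negative entries are cut to 0, so this inverts \<open>expo\<close> on nonnegative
  vectors only; \<open>gcoeff\<close> and \<open>gmonom\<close> guard against the others.\<close>

definition of_expo :: "('n::finite \<Rightarrow> int) \<Rightarrow> 'n \<Rightarrow>\<^sub>0 nat" where
  "of_expo \<delta> = Abs_poly_mapping (\<lambda>l. nat (\<delta> l))"

lemma lookup_of_expo [simp]: "Poly_Mapping.lookup (of_expo \<delta>) l = nat (\<delta> l)"
  by (simp add: of_expo_def)

lemma expo_of_expo [simp]: "0 \<le> \<delta> \<Longrightarrow> expo (of_expo \<delta>) = \<delta>"
  by (auto simp: expo_def le_fun_def)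

lemma of_expo_expo [simp]: "of_expo (expo m) = m"
  by (rule poly_mapping_eqI) (simp add: expo_def)

lemma expo_nonneg [simp]: "0 \<le> expo m"
  by (simp add: expo_def le_fun_def)

lemma expo_add: "expo (m + m') = expo m + expo m'"
  by (simp add: expo_def lookup_add fun_eq_iff)

lemma expo_inject [simp]: "expo m = expo m' \<longleftrightarrow> m = m'" for m m' :: "'n::finite \<Rightarrow>\<^sub>0 nat"
  by (metis of_expo_expo)

definition gcoeff :: "('n::finite \<Rightarrow> int) \<Rightarrow> ('n, 'k::field) mpoly \<Rightarrow> 'k" where
  "gcoeff \<delta> p = (if 0 \<le> \<delta> then Poly_Mapping.lookup p (of_expo \<delta>) else 0)"

definition gmonom :: "('n::finite \<Rightarrow> int) \<Rightarrow> 'k::field \<Rightarrow> ('n, 'k) mpoly" where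
  "gmonom \<delta> x = (if 0 \<le> \<delta> then Poly_Mapping.single (of_expo \<delta>) x else 0)"

lemma gcoeff_0 [simp]: "gcoeff \<delta> 0 = 0"
  by (simp add: gcoeff_def)

lemma gmonom_0 [simp]: "gmonom \<delta> 0 = 0"
  by (simp add: gmonom_def)

lemma gcoeff_add: "gcoeff \<delta> (p + q) = gcoeff \<delta> p + gcoeff \<delta> q"
  by (simp add: gcoeff_def lookup_add)

lemma gcoeff_sum: "gcoeff \<delta> (sum f A) = (\<Sum>x\<in>A. gcoeff \<delta> (f x))"
  by (induction A rule: infinite_finite_induct) (simp_all add: gcoeff_add)

lemma gcoeff_expo: "gcoeff (expo m) p = Poly_Mapping.lookup p m"
  by (simp add: gcoeff_def)

lemma gcoeff_eqI: "(\<And>\<delta>. gcoeff \<delta> p = gcoeff \<delta> q) \<Longrightarrow> p = q"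
  by (rule poly_mapping_eqI) (metis gcoeff_expo)

lemma gcoeff_nonzero: "gcoeff \<delta> p \<noteq> 0 \<longleftrightarrow> (\<exists>m\<in>Poly_Mapping.keys p. expo m = \<delta>)"
proof
  assume "gcoeff \<delta> p \<noteq> 0"
  then have "0 \<le> \<delta>" "of_expo \<delta> \<in> Poly_Mapping.keys p"
    by (auto simp: gcoeff_def in_keys_iff split: if_splits)
  then show "\<exists>m\<in>Poly_Mapping.keys p. expo m = \<delta>" using expo_of_expo by blast
qed (auto simp: gcoeff_expo in_keys_iff)

lemma gcoeff_gmonom: "gcoeff \<delta> (gmonom \<epsilon> x) = (if \<delta> = \<epsilon> \<and> 0 \<le> \<delta> then x else 0)"
proof -
  have "of_expo \<delta> = of_expo \<epsilon> \<longleftrightarrow> \<delta> = \<epsilon>" if "0 \<le> \<delta>" "0 \<le> \<epsilon>"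
    using that by (metis expo_of_expo)
  then show ?thesis by (auto simp: gcoeff_def gmonom_def lookup_single when_def)
qed

lemma lookup_single_mult:
  fixes p :: "('n, 'k::field) mpoly"
  shows "Poly_Mapping.lookup (Poly_Mapping.single k x * p) m =
    (\<Sum>q\<in>Poly_Mapping.keys p. if m = k + q then x * Poly_Mapping.lookup p q else 0)"
proof -
  have "Poly_Mapping.lookup (Poly_Mapping.single k x * p) m =
      x * (\<Sum>q. Poly_Mapping.lookup p q when m = k + q)"
    unfolding lookup_mult by (subst Sum_any.expand_superset[of "{k}"]) (auto simp: lookup_single when_def)
  also have "(\<Sum>q. Poly_Mapping.lookup p q when m = k + q) =
      (\<Sum>q\<in>Poly_Mapping.keys p. Poly_Mapping.lookup p q when m = k + q)"
    by (rule Sum_any.expand_superset) (auto simp: when_def in_keys_iff)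
  finally show ?thesis by (simp add: sum_distrib_left when_def if_distrib cong: if_cong)
qed

text \<open>Nonnegativity of \<open>\<epsilon>\<close> is demanded only for a nonzero coefficient,
  since zero entries of a graded matrix may sit at negative degree differences.\<close>

lemma gcoeff_gmonom_mult:
  assumes "x \<noteq> 0 \<Longrightarrow> 0 \<le> \<epsilon>"
  shows "gcoeff \<delta> (gmonom \<epsilon> x * p) = x * gcoeff (\<delta> - \<epsilon>) p"
proof (cases "x = 0")
  case False
  then have \<epsilon>: "0 \<le> \<epsilon>" using assms by blast
  have *: "of_expo \<delta> = of_expo \<epsilon> + q \<longleftrightarrow> \<delta> - \<epsilon> = expo q" if "0 \<le> \<delta>" for q
  proof -
    have "of_expo \<delta> = of_expo \<epsilon> + q \<longleftrightarrow> expo (of_expo \<delta>) = expo (of_expo \<epsilon> + q)" by simp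
    also have "\<dots> \<longleftrightarrow> \<delta> - \<epsilon> = expo q" using that \<epsilon> by (auto simp: expo_add fun_eq_iff diff_eq_eq add.commute)
    finally show ?thesis .
  qed
  have le: "0 \<le> \<delta>" if "0 \<le> \<delta> - \<epsilon>" using that \<epsilon> by (fastforce simp: le_fun_def intro: order_trans)
  show ?thesis
  proof (cases "0 \<le> \<delta>")
    case True
    have "gcoeff \<delta> (gmonom \<epsilon> x * p) =
        (\<Sum>q\<in>Poly_Mapping.keys p. if \<delta> - \<epsilon> = expo q then x * Poly_Mapping.lookup p q else 0)"
      using True \<epsilon> by (simp add: gcoeff_def gmonom_def lookup_single_mult *)
    also have "\<dots> = x * gcoeff (\<delta> - \<epsilon>) p"
    proof (cases "0 \<le> \<delta> - \<epsilon>")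
      case True
      then have "\<delta> - \<epsilon> = expo q \<longleftrightarrow> q = of_expo (\<delta> - \<epsilon>)" for q by auto
      then show ?thesis using True by (simp add: gcoeff_def in_keys_iff)
    next
      case False
      then have "\<delta> - \<epsilon> \<noteq> expo q" for q using expo_nonneg[of q] by metis
      then show ?thesis using False by (simp add: gcoeff_def)
    qed
    finally show ?thesis .
  qed (use le in \<open>auto simp: gcoeff_def\<close>)
qed simp

text \<open>A multidegree determines its monomial, so there is at most one term. This is what
  reduces graded matrices to scalars.\<close>

lemma homogeneous_eq_gmonom:
  assumes "homogeneous \<delta> p"
  shows "p = gmonom \<delta> (gcoeff \<delta> p)"
proof (rule gcoeff_eqI)
  fix \<epsilon>
  have "\<epsilon> = \<delta> \<and> 0 \<le> \<delta>" if "gcoeff \<epsilon> p \<noteq> 0"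
  proof -
    obtain m where "m \<in> Poly_Mapping.keys p" "expo m = \<epsilon>" using \<open>gcoeff \<epsilon> p \<noteq> 0\<close> gcoeff_nonzero by blast
    then show ?thesis using assms expo_nonneg[of m] by (auto simp: homogeneous_def expo_def)
  qed
  then show "gcoeff \<epsilon> p = gcoeff \<epsilon> (gmonom \<delta> (gcoeff \<delta> p))" by (auto simp: gcoeff_gmonom)
qed

lemma homogeneous_gmonom: "homogeneous \<delta> (gmonom \<delta> x)"
  by (auto simp: homogeneous_def gmonom_def le_fun_def split: if_splits)

section \<open>Graded polynomial matrices and their scalar matrices\<close>

definition free_mod :: "nat \<Rightarrow> (nat \<Rightarrow> ('n, 'k::field) mpoly) set" where
  "free_mod n = {v. \<forall>j\<ge>n. v j = 0}"

definition pmat :: "nat \<Rightarrow> nat \<Rightarrow> (nat \<Rightarrow> nat \<Rightarrow> ('n, 'k::field) mpoly) \<Rightarrow> (nat \<Rightarrow> ('n, 'k) mpoly) \<Rightarrow> nat \<Rightarrow> ('n, 'k) mpoly" where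
  "pmat m n P v = (\<lambda>k. if k < m then \<Sum>j<n. P k j * v j else 0)"

definition component :: "(nat \<Rightarrow> 'n::finite \<Rightarrow> int) \<Rightarrow> ('n \<Rightarrow> int) \<Rightarrow> (nat \<Rightarrow> ('n, 'k::field) mpoly) \<Rightarrow> nat \<Rightarrow> 'k" where
  "component a \<beta> v = (\<lambda>j. gcoeff (\<beta> - a j) (v j))"

definition matches ::
    "nat \<Rightarrow> nat \<Rightarrow> (nat \<Rightarrow> 'n::finite \<Rightarrow> int) \<Rightarrow> (nat \<Rightarrow> 'n \<Rightarrow> int) \<Rightarrow> (nat \<Rightarrow> nat \<Rightarrow> 'k::field) \<Rightarrow> (nat \<Rightarrow> nat \<Rightarrow> ('n, 'k) mpoly) \<Rightarrow> bool" where
  "matches m n a b c P \<longleftrightarrow> graded_matrix m n a b c \<and> (\<forall>k<m. \<forall>j<n. P k j = gmonom (b j - a k) (c k j))"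

lemma component_pmat:
  assumes "matches m n a b c P"
  shows "component a \<beta> (pmat m n P v) = mat m n c (component b \<beta> v)"
proof
  fix k
  show "component a \<beta> (pmat m n P v) k = mat m n c (component b \<beta> v) k"
  proof (cases "k < m")
    case True
    have "gcoeff (\<beta> - a k) (P k j * v j) = c k j * gcoeff (\<beta> - b j) (v j)" if "j < n" for j
    proof -
      have "c k j \<noteq> 0 \<Longrightarrow> 0 \<le> b j - a k"
        using assms True that by (auto simp: matches_def graded_matrix_def le_fun_def)
      moreover have "\<beta> - a k - (b j - a k) = \<beta> - b j" by simp
      ultimately show ?thesis
        using gcoeff_gmonom_mult[of "c k j" "b j - a k" "\<beta> - a k" "v j"] assms True that
        by (simp add: matches_def)
    qed
    then show ?thesis using True by (simp add: component_def pmat_def mat_def gcoeff_sum)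
  qed (simp add: component_def pmat_def mat_def)
qed

lemma component_free_part:
  assumes "v \<in> free_mod n"
  shows "component b \<beta> v \<in> free_part n b \<beta>"
  unfolding free_part_def
proof (intro CollectI allI impI)
  fix j assume j: "component b \<beta> v j \<noteq> 0"
  then have "0 \<le> \<beta> - b j" by (auto simp: component_def gcoeff_def split: if_splits)
  moreover have "j < n"
  proof (rule ccontr)
    assume "\<not> j < n"
    then have "v j = 0" using assms by (simp add: free_mod_def)
    then show False using j by (simp add: component_def)
  qed
  ultimately show "j < n \<and> b j \<le> \<beta>" by (auto simp: le_fun_def)
qed

lemma component_eqI:
  assumes "\<And>\<beta>. component b \<beta> v = component b \<beta> v'"
  shows "v = v'"
proof
  fix j show "v j = v' j"
  proof (rule gcoeff_eqI)
    fix \<delta> show "gcoeff \<delta> (v j) = gcoeff \<delta> (v' j)"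
      using fun_cong[OF assms[of "\<delta> + b j"], of j] by (simp add: component_def)
  qed
qed

lemma component_zero [simp]: "component b \<beta> 0 = 0"
  by (simp add: component_def fun_eq_iff)

lemma finite_components:
  assumes "v \<in> free_mod n"
  shows "finite {\<beta>. component b \<beta> v \<noteq> 0}"
proof (rule finite_subset)
  show "{\<beta>. component b \<beta> v \<noteq> 0} \<subseteq> (\<Union>j<n. (\<lambda>m. expo m + b j) ` Poly_Mapping.keys (v j))"
  proof clarify
    fix \<beta> assume "component b \<beta> v \<noteq> 0"
    then obtain j where j: "gcoeff (\<beta> - b j) (v j) \<noteq> 0" by (auto simp: component_def fun_eq_iff)
    then have "j < n" using assms by (metis (mono_tags, lifting) free_mod_def gcoeff_0 mem_Collect_eq not_less)
    moreover obtain m where m: "m \<in> Poly_Mapping.keys (v j)" "expo m = \<beta> - b j"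
      using j gcoeff_nonzero by blast
    moreover have "\<beta> = expo m + b j" using m(2) by simp
    ultimately show "\<beta> \<in> (\<Union>j<n. (\<lambda>m. expo m + b j) ` Poly_Mapping.keys (v j))" by blast
  qed
qed simp

text \<open>A polynomial vector has only finitely many nonzero components, hence the finite set
  \<open>B\<close> outside which \<open>u\<close> vanishes.\<close>

lemma glue_components:
  assumes fin: "finite B" and u: "\<And>\<beta>. u \<beta> \<in> free_part n b \<beta>" "\<And>\<beta>. \<beta> \<notin> B \<Longrightarrow> u \<beta> = 0"
  obtains v where "v \<in> free_mod n" "\<And>\<beta>. component b \<beta> v = u \<beta>"
proof
  let ?v = "\<lambda>j. if j < n then \<Sum>\<beta>\<in>B. gmonom (\<beta> - b j) (u \<beta> j) else 0"
  show "?v \<in> free_mod n" by (simp add: free_mod_def)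
  fix \<gamma>
  show "component b \<gamma> ?v = u \<gamma>"
  proof
    fix j
    have out: "u \<gamma> j = 0" if "\<not> (j < n \<and> b j \<le> \<gamma>)"
      using u(1)[of \<gamma>] that unfolding free_part_def by blast
    have "(\<Sum>\<beta>\<in>B. gcoeff (\<gamma> - b j) (gmonom (\<beta> - b j) (u \<beta> j))) = u \<gamma> j" if "j < n"
    proof -
      have "gcoeff (\<gamma> - b j) (gmonom (\<beta> - b j) (u \<beta> j)) = (if \<beta> = \<gamma> then u \<gamma> j else 0)" for \<beta>
      proof (cases "b j \<le> \<gamma>")
        case True
        then have "0 \<le> \<gamma> - b j" by (simp add: le_fun_def)
        then show ?thesis by (auto simp: gcoeff_gmonom)
      next
        case False
        then have "\<not> 0 \<le> \<gamma> - b j" by (simp add: le_fun_def)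
        then show ?thesis using False out by (auto simp: gcoeff_def)
      qed
      then show ?thesis using fin u(2)[of \<gamma>] by (simp add: zero_fun_def)
    qed
    then show "component b \<gamma> ?v j = u \<gamma> j"
      using out by (simp add: component_def gcoeff_sum)
  qed
qed

definition graded_set :: "nat \<Rightarrow> (nat \<Rightarrow> 'n::finite \<Rightarrow> int) \<Rightarrow> (('n \<Rightarrow> int) \<Rightarrow> (nat \<Rightarrow> 'k::field) set) \<Rightarrow> (nat \<Rightarrow> ('n, 'k) mpoly) set" where
  "graded_set n b X = {v\<in>free_mod n. \<forall>\<beta>. component b \<beta> v \<in> X \<beta>}"

text \<open>A single \<open>w\<close> is tested by gluing it with zeros in all other degrees; this
  is why 0 must lie in every \<open>X \<beta>\<close>.\<close>

lemma graded_set_subset_iff: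
  assumes X: "\<And>\<beta>. X \<beta> \<subseteq> free_part n b \<beta>" "\<And>\<beta>. 0 \<in> X \<beta>"
  shows "graded_set n b X \<subseteq> graded_set n b Y \<longleftrightarrow> (\<forall>\<beta>. X \<beta> \<subseteq> Y \<beta>)"
proof (intro iffI allI subsetI)
  fix \<beta> w assume sub: "graded_set n b X \<subseteq> graded_set n b Y" and w: "w \<in> X \<beta>"
  obtain v where v: "v \<in> free_mod n" "\<And>\<gamma>. component b \<gamma> v = (if \<gamma> = \<beta> then w else 0)"
  proof (rule glue_components[of "{\<beta>}" "\<lambda>\<gamma>. if \<gamma> = \<beta> then w else 0" n b])
    show "(if \<gamma> = \<beta> then w else 0) \<in> free_part n b \<gamma>" for \<gamma>
      using X[of \<gamma>] w by (auto split: if_splits)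
  qed auto
  have "v \<in> graded_set n b X" using v w X(2) by (simp add: graded_set_def)
  then have "component b \<beta> v \<in> Y \<beta>" using sub by (auto simp: graded_set_def)
  then show "w \<in> Y \<beta>" using v(2) by simp
qed (auto simp: graded_set_def)

lemma graded_set_eq_iff:
  assumes "\<And>\<beta>. X \<beta> \<subseteq> free_part n b \<beta>" "\<And>\<beta>. 0 \<in> X \<beta>" "\<And>\<beta>. Y \<beta> \<subseteq> free_part n b \<beta>" "\<And>\<beta>. 0 \<in> Y \<beta>"
  shows "graded_set n b X = graded_set n b Y \<longleftrightarrow> (\<forall>\<beta>. X \<beta> = Y \<beta>)"
  using graded_set_subset_iff[OF assms(1,2), of Y] graded_set_subset_iff[OF assms(3,4), of X] by blast

lemma pmat_kernel:
  assumes "matches m n a b c P"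
  shows "{v\<in>free_mod n. pmat m n P v = 0} = graded_set n b (\<lambda>\<beta>. {w\<in>free_part n b \<beta>. mat m n c w = 0})"
proof -
  have "pmat m n P v = 0 \<longleftrightarrow> (\<forall>\<beta>. mat m n c (component b \<beta> v) = 0)" for v
    using component_eqI[of a "pmat m n P v" 0]
    by (auto simp: component_pmat[OF assms, symmetric])
  then show ?thesis using component_free_part by (auto simp: graded_set_def)
qed

lemma pmat_image:
  assumes P: "matches m n a b c P"
  shows "pmat m n P ` free_mod n = graded_set m a (\<lambda>\<beta>. mat m n c ` free_part n b \<beta>)"
proof
  show "pmat m n P ` free_mod n \<subseteq> graded_set m a (\<lambda>\<beta>. mat m n c ` free_part n b \<beta>)"
    by (auto simp: graded_set_def component_pmat[OF P] intro!: imageI component_free_part)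
       (simp add: free_mod_def pmat_def)
  show "graded_set m a (\<lambda>\<beta>. mat m n c ` free_part n b \<beta>) \<subseteq> pmat m n P ` free_mod n"
  proof
    fix v assume v: "v \<in> graded_set m a (\<lambda>\<beta>. mat m n c ` free_part n b \<beta>)"
    \<comment> \<open>The preimage is taken to be 0 wherever the component vanishes, which leaves
      only finitely many nonzero choices to glue.\<close>
    have "\<exists>w. w \<in> free_part n b \<beta> \<and> component a \<beta> v = mat m n c w \<and> (component a \<beta> v = 0 \<longrightarrow> w = 0)" for \<beta>
    proof (cases "component a \<beta> v = 0")
      case True
      then show ?thesis using lin_zero[OF lin_mat[of m n c]]
        by (intro exI[of _ 0]) (simp add: free_part_def)
    next
      case False
      then show ?thesis using v by (auto simp: graded_set_def)
    qed
    from choice[OF allI[OF this]] obtain u where u: "\<forall>\<beta>. u \<beta> \<in> free_part n b \<beta> \<and>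
      component a \<beta> v = mat m n c (u \<beta>) \<and> (component a \<beta> v = 0 \<longrightarrow> u \<beta> = 0)" ..
    obtain v' where v': "v' \<in> free_mod n" "\<And>\<beta>. component b \<beta> v' = u \<beta>"
    proof (rule glue_components)
      show "finite {\<beta>. component a \<beta> v \<noteq> 0}"
        using v by (intro finite_components) (auto simp: graded_set_def)
      show "u \<beta> \<in> free_part n b \<beta>" for \<beta> using u by blast
      show "u \<beta> = 0" if "\<beta> \<notin> {\<beta>. component a \<beta> v \<noteq> 0}" for \<beta> using u that by blast
    qed (rule that)
    have "v = pmat m n P v'"
      by (rule component_eqI[of a]) (simp add: component_pmat[OF P] v' u)
    then show "v \<in> pmat m n P ` free_mod n" using v' by blast
  qed
qed

lemma exactness_iff:
  assumes P: "matches m n a b c P" and P': "matches n l b d c' P'"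
  shows "{v\<in>free_mod n. pmat m n P v = 0} = pmat n l P' ` free_mod l \<longleftrightarrow>
    (\<forall>\<beta>. {w\<in>free_part n b \<beta>. mat m n c w = 0} = mat n l c' ` free_part l d \<beta>)"
  unfolding pmat_kernel[OF P] pmat_image[OF P']
proof (rule graded_set_eq_iff)
  show "0 \<in> {w\<in>free_part n b \<beta>. mat m n c w = 0}" for \<beta>
    using lin_zero[OF lin_mat[of m n c]] by (simp add: free_part_def)
  show "0 \<in> mat n l c' ` free_part l d \<beta>" for \<beta>
    using lin_zero[OF lin_mat[of n l c']] by (intro rev_image_eqI[of 0]) (simp_all add: free_part_def)
  show "mat n l c' ` free_part l d \<beta> \<subseteq> free_part n b \<beta>" for \<beta>
    using mat_free_part P' by (auto simp: matches_def)
qed auto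

text \<open>A monomial ideal as a submodule of the ring, seen as the free module on coordinate 0 in
  degree 0: the component is a line for exponents in \<open>A\<close> and zero otherwise.\<close>

definition ideal_part :: "('n \<Rightarrow> int) set \<Rightarrow> ('n \<Rightarrow> int) \<Rightarrow> (nat \<Rightarrow> 'k::field) set" where
  "ideal_part A \<beta> = {w. \<forall>j. w j \<noteq> 0 \<longrightarrow> j = 0 \<and> \<beta> \<in> A}"

definition supported :: "('n \<Rightarrow> int) set \<Rightarrow> ('n, 'k::field) mpoly set" where
  "supported A = {p. \<forall>m\<in>Poly_Mapping.keys p. expo m \<in> A}"

lemma augmentation_iff:
  fixes c :: "nat \<Rightarrow> nat \<Rightarrow> 'k::field" and A :: "('n::finite \<Rightarrow> int) set"
  assumes P: "matches 1 n (\<lambda>_. 0) b c P" and A: "\<And>\<beta>. \<beta> \<in> A \<Longrightarrow> 0 \<le> \<beta>"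
  shows "(\<lambda>v. \<Sum>j<n. P 0 j * v j) ` free_mod n = supported A \<longleftrightarrow>
    (\<forall>\<beta>. mat 1 n c ` free_part n b \<beta> = ideal_part A \<beta>)"
proof -
  let ?e = "\<lambda>(p :: ('n, 'k) mpoly) k. if k = (0::nat) then p else 0"
  have inj: "inj ?e" by (rule injI) (metis (full_types))
  have "pmat 1 n P = ?e \<circ> (\<lambda>v. \<Sum>j<n. P 0 j * v j)"
    by (auto simp: pmat_def fun_eq_iff)
  then have 1: "pmat 1 n P ` free_mod n = ?e ` ((\<lambda>v. \<Sum>j<n. P 0 j * v j) ` free_mod n)"
    by (simp add: image_comp)
  have 2: "?e ` supported A = graded_set 1 (\<lambda>_. 0) (ideal_part A)"
  proof -
    have "component (\<lambda>_. 0) \<beta> (?e p) \<in> ideal_part A \<beta> \<longleftrightarrow> (gcoeff \<beta> p \<noteq> 0 \<longrightarrow> \<beta> \<in> A)" for \<beta> p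
      by (auto simp: component_def ideal_part_def)
    then have mem: "?e p \<in> graded_set 1 (\<lambda>_. 0) (ideal_part A) \<longleftrightarrow> p \<in> supported A" for p
      by (auto simp: graded_set_def free_mod_def supported_def gcoeff_nonzero)
    have eq: "v = ?e (v 0)" if "v \<in> graded_set 1 (\<lambda>_. 0) (ideal_part A)" for v
      using that by (auto simp: graded_set_def free_mod_def fun_eq_iff)
    show ?thesis
    proof (intro equalityI subsetI)
      fix v :: "nat \<Rightarrow> ('n, 'k) mpoly" assume v: "v \<in> graded_set 1 (\<lambda>_. 0) (ideal_part A)"
      then have "v 0 \<in> supported A" using mem[of "v 0"] eq[OF v] by simp
      then show "v \<in> ?e ` supported A" using eq[OF v] by (rule rev_image_eqI)
    qed (use mem in auto)
  qed
  have "(\<lambda>v. \<Sum>j<n. P 0 j * v j) ` free_mod n = supported A \<longleftrightarrow>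
      pmat 1 n P ` free_mod n = ?e ` supported A"
    unfolding 1 by (rule inj_image_eq_iff[OF inj, symmetric])
  also have "\<dots> \<longleftrightarrow> (\<forall>\<beta>. mat 1 n c ` free_part n b \<beta> = ideal_part A \<beta>)"
    unfolding 2 pmat_image[OF P]
  proof (rule graded_set_eq_iff)
    show "0 \<in> mat 1 n c ` free_part n b \<beta>" for \<beta>
      using lin_zero[OF lin_mat[of 1 n c]] by (intro rev_image_eqI[of 0]) (simp_all add: free_part_def)
    show "mat 1 n c ` free_part n b \<beta> \<subseteq> free_part 1 (\<lambda>_. 0) \<beta>" for \<beta>
      using mat_free_part P by (auto simp: matches_def)
    show "ideal_part A \<beta> \<subseteq> free_part 1 (\<lambda>_. 0) \<beta>" for \<beta>
      using A by (auto simp: ideal_part_def free_part_def)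
  qed (simp add: ideal_part_def)
  finally show ?thesis .
qed

text \<open>
  The augmentation is treated as one more differential: step \<open>0\<close> is the ring itself, and step
  \<open>q + 1\<close> is the free module \<open>F\<^sub>q\<close>.
\<close>

definition step_rank :: "('n, 'k::field) graded_seq \<Rightarrow> nat \<Rightarrow> nat" where
  "step_rank F q = (case q of 0 \<Rightarrow> 1 | Suc q \<Rightarrow> grank F q)"

definition step_deg :: "('n, 'k::field) graded_seq \<Rightarrow> nat \<Rightarrow> nat \<Rightarrow> 'n \<Rightarrow> int" where
  "step_deg F q = (case q of 0 \<Rightarrow> \<lambda>_. 0 | Suc q \<Rightarrow> gdeg F q)"

definition step_diff :: "('n, 'k::field) graded_seq \<Rightarrow> nat \<Rightarrow> nat \<Rightarrow> nat \<Rightarrow> ('n, 'k) mpoly" where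
  "step_diff F q = (case q of 0 \<Rightarrow> \<lambda>_. aug F | Suc q \<Rightarrow> gdiff F q)"

text \<open>Used both ways: left to right it turns the resolution behind a Betti number into scalar
  matrices, right to left it certifies the resolution built from scalar matrices.\<close>

lemma free_resolution_iff:
  fixes F :: "('n::finite, 'k::field) graded_seq"
  assumes P: "\<And>q. matches (step_rank F q) (step_rank F (Suc q)) (step_deg F q) (step_deg F (Suc q)) (c q) (step_diff F q)"
    and A: "\<And>\<beta>. \<beta> \<in> A \<Longrightarrow> 0 \<le> \<beta>"
  shows "free_resolution F (supported A) \<longleftrightarrow>
    graded_resolution (step_rank F) (step_deg F) c \<and>
    (\<forall>\<beta>. graded_resolution.syz (step_rank F) (step_deg F) c 0 \<beta> = ideal_part A \<beta>)"
proof -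
  let ?r = "step_rank F" and ?a = "step_deg F"
  have hom: "homogeneous (?a (Suc q) j - ?a q k) (step_diff F q k j)" if "k < ?r q" "j < ?r (Suc q)" for q k j
    using P[of q] that homogeneous_gmonom by (simp add: matches_def)
  have h0: "\<forall>j < grank F 0. homogeneous (gdeg F 0 j) (aug F j)"
    using hom[of 0 0] by (simp add: step_rank_def step_deg_def step_diff_def)
  have h1: "\<forall>i. \<forall>k < grank F i. \<forall>j < grank F (Suc i). homogeneous (gdeg F (Suc i) j - gdeg F i k) (gdiff F i k j)"
    using hom[of _ "Suc _"] by (simp add: step_rank_def step_deg_def step_diff_def)
  have gr: "graded_matrix (?r q) (?r (Suc q)) (?a q) (?a (Suc q)) (c q)" for q
    using P[of q] by (simp add: matches_def)
  have fm: "free_module F q = free_mod (?r (Suc q))" for q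
    by (simp add: free_module_def free_mod_def step_rank_def)
  have dm: "diff_map F q = pmat (?r (Suc q)) (?r (Suc (Suc q))) (step_diff F (Suc q))" for q
    by (simp add: diff_map_def pmat_def step_rank_def step_diff_def fun_eq_iff)
  have am: "aug_map F v = 0 \<longleftrightarrow> pmat (?r 0) (?r (Suc 0)) (step_diff F 0) v = 0" for v
    by (auto simp: aug_map_def pmat_def step_rank_def step_diff_def fun_eq_iff)
  have aug: "aug_map F ` free_module F 0 = supported A \<longleftrightarrow>
      (\<forall>\<beta>. mat (?r 0) (?r (Suc 0)) (c 0) ` free_part (?r (Suc 0)) (?a (Suc 0)) \<beta> = ideal_part A \<beta>)"
    using augmentation_iff[of "?r (Suc 0)" "?a (Suc 0)" "c 0" "step_diff F 0" A] P[of 0] A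
    by (simp add: fm aug_map_def[abs_def] step_rank_def step_deg_def step_diff_def)
  let ?E = "\<lambda>q. {v\<in>free_mod (?r (Suc q)). pmat (?r q) (?r (Suc q)) (step_diff F q) v = 0} =
    pmat (?r (Suc q)) (?r (Suc (Suc q))) (step_diff F (Suc q)) ` free_mod (?r (Suc (Suc q)))"
  have "free_resolution F (supported A) \<longleftrightarrow> aug_map F ` free_module F 0 = supported A \<and> ?E 0 \<and> (\<forall>q. ?E (Suc q))"
    unfolding free_resolution_def using h0 h1 by (simp add: fm dm am zero_fun_def)
  also have "\<dots> \<longleftrightarrow> aug_map F ` free_module F 0 = supported A \<and> (\<forall>q. ?E q)"
  proof -
    have nat_all: "(\<forall>q. Q q) \<longleftrightarrow> Q 0 \<and> (\<forall>q. Q (Suc q))" for Q :: "nat \<Rightarrow> bool"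
      by (metis not0_implies_Suc)
    have "(\<forall>q. ?E q) \<longleftrightarrow> ?E 0 \<and> (\<forall>q. ?E (Suc q))" by (rule nat_all)
    then show ?thesis by (simp only:)
  qed
  also have "\<dots> \<longleftrightarrow> (\<forall>\<beta>. mat (?r 0) (?r (Suc 0)) (c 0) ` free_part (?r (Suc 0)) (?a (Suc 0)) \<beta> = ideal_part A \<beta>) \<and>
      graded_resolution ?r ?a c"
    unfolding aug exactness_iff[OF P P] graded_resolution_def using gr by blast
  also have "\<dots> \<longleftrightarrow> graded_resolution ?r ?a c \<and>
      (\<forall>\<beta>. graded_resolution.syz ?r ?a c 0 \<beta> = ideal_part A \<beta>)"
    using graded_resolution.syz_def[of ?r ?a c 0] by auto
  finally show ?thesis .
qed

text \<open>As \<open>F\<close> is absent from the right-hand side, this also gives the independence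
  of Tor from the resolution.\<close>

lemma tor_dim_eq_kos_dim:
  fixes F :: "('n::finite, 'k::field) graded_seq"
  assumes F: "free_resolution F (supported A)" and A: "\<And>\<beta>. \<beta> \<in> A \<Longrightarrow> 0 \<le> \<beta>"
  shows "tor_dim F i \<alpha> = kos_dim (ideal_part A :: _ \<Rightarrow> (nat \<Rightarrow> 'k) set) i \<alpha>"
proof -
  let ?r = "step_rank F" and ?a = "step_deg F"
  define c where "c q k j = gcoeff (?a (Suc q) j - ?a q k) (step_diff F q k j)" for q k j
  have hom: "homogeneous (?a (Suc q) j - ?a q k) (step_diff F q k j)" if "k < ?r q" "j < ?r (Suc q)" for q k j
    using F that unfolding free_resolution_def
    by (cases q) (auto simp: step_rank_def step_deg_def step_diff_def)
  have "?a q k \<le> ?a (Suc q) j" if "c q k j \<noteq> 0" for q k j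
    using that by (auto simp: c_def gcoeff_def le_fun_def split: if_splits)
  then have P: "matches (?r q) (?r (Suc q)) (?a q) (?a (Suc q)) (c q) (step_diff F q)" for q
    using homogeneous_eq_gmonom[OF hom] by (simp add: matches_def graded_matrix_def c_def)
  have R: "graded_resolution ?r ?a c" and syz: "\<forall>\<beta>. graded_resolution.syz ?r ?a c 0 \<beta> = ideal_part A \<beta>"
    using free_resolution_iff[OF P A] F by blast+
  interpret graded_resolution ?r ?a c by (rule R)
  have sp: "tensor_space F q \<alpha> = top_space (Suc q) \<alpha>" for q
    by (auto simp: tensor_space_def top_space_def gens_of_degree_def step_rank_def step_deg_def)
  have mp: "tensor_map F q \<alpha> = top_map (Suc q) \<alpha>" for q
  proof -
    \<comment> \<open>Between generators of the same degree the entry has degree 0, so its constant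
      term is its whole scalar.\<close>
    have "Poly_Mapping.lookup (gdiff F q k j) 0 = c (Suc q) k j"
      if "gdeg F q k = \<alpha>" "gdeg F (Suc q) j = \<alpha>" for k j
      using that gcoeff_expo[of 0 "gdiff F q k j"] by (simp add: c_def step_deg_def step_diff_def expo_def flip: zero_fun_def)
    then show ?thesis
      by (auto simp: tensor_map_def top_map_def gens_of_degree_def step_rank_def step_deg_def fun_eq_iff intro!: sum.cong)
  qed
  have "tor_cycles F i \<alpha> = top_cycles i \<alpha>"
    by (cases i) (simp_all add: sp mp zero_fun_def)
  moreover have "tor_boundaries F i \<alpha> = top_map (Suc i) \<alpha> ` top_space (Suc (Suc i)) \<alpha>"
    by (simp add: tor_boundaries_def sp mp)
  moreover have "syz 0 = ideal_part A" using syz by blast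
  ultimately show ?thesis
    using top_homology_eq_kos_dim[of i \<alpha>] by (simp add: tor_dim_def)
qed

section \<open>Existence of free resolutions\<close>

text \<open>A nonincreasing sequence of naturals is constant once it attains its minimum, so its
  tail is also nondecreasing.\<close>

lemma nat_incseq_subseq:
  fixes s :: "nat \<Rightarrow> nat"
  obtains h where "strict_mono h" "incseq (\<lambda>k. s (h k))"
proof -
  obtain h where h: "strict_mono h" "monoseq (\<lambda>k. s (h k))" using seq_monosub[of s] by blast
  show thesis
  proof (cases "incseq (\<lambda>k. s (h k))")
    case True
    then show thesis using that h(1) by blast
  next
    case False
    then have dec: "decseq (\<lambda>k. s (h k))" using h(2) by (simp add: monoseq_iff)
    obtain K where K: "\<And>k. s (h K) \<le> s (h k)"
      using ex_has_least_nat[of "\<lambda>_. True" 0 "\<lambda>k. s (h k)"] by blast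
    have "s (h (K + k)) = s (h K)" for k
      using K[of "K + k"] decseqD[OF dec, of K "K + k"] by simp
    then have "incseq (\<lambda>k. s (h (K + k)))" by (simp add: incseq_def)
    moreover have "strict_mono (\<lambda>k. h (K + k))" using h(1) by (simp add: strict_mono_def)
    ultimately show thesis using that by blast
  qed
qed

text \<open>Variables are treated one at a time, each by a further subsequence, which keeps the
  earlier coordinates nondecreasing.\<close>

lemma dickson:
  fixes s :: "nat \<Rightarrow> 'n::finite \<Rightarrow> int"
  assumes nonneg: "\<And>k. 0 \<le> s k"
  obtains f where "strict_mono f" "incseq (\<lambda>k. s (f k))"
proof -
  have "\<exists>f. strict_mono f \<and> (\<forall>l\<in>S. incseq (\<lambda>k. s (f k) l))" if "finite S" for S
    using that
  proof induction
    case empty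
    show ?case by (intro exI[of _ id]) (simp add: strict_mono_def)
  next
    case (insert x S)
    then obtain f where f: "strict_mono f" "\<forall>l\<in>S. incseq (\<lambda>k. s (f k) l)" by blast
    obtain h where h: "strict_mono h" "incseq (\<lambda>k. nat (s (f (h k)) x))"
      by (rule nat_incseq_subseq[of "\<lambda>k. nat (s (f k) x)"])
    have "strict_mono (\<lambda>k. f (h k))" using f(1) h(1) by (simp add: strict_mono_def)
    moreover have "incseq (\<lambda>k. s (f (h k)) l)" if "l \<in> S" for l
      using f(2) h(1) that unfolding incseq_def by (meson strict_mono_less_eq)
    moreover have "incseq (\<lambda>k. s (f (h k)) x)"
      using h(2) nonneg unfolding incseq_def le_fun_def by (simp add: nat_le_eq_zle)
    ultimately show ?case by (intro exI[of _ "\<lambda>k. f (h k)"]) auto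
  qed
  from this[OF finite_UNIV] obtain f where "strict_mono f" "\<forall>l. incseq (\<lambda>k. s (f k) l)" by auto
  then show thesis by (intro that[of f]) (auto simp: incseq_def le_fun_def)
qed

text \<open>
  By Dickson's lemma, infinitely many jumps would contain an increasing chain, along which the
  dimension of \<open>N \<beta> \<subseteq> K\<^sup>m\<close> would grow strictly.
\<close>

lemma finite_jumps:
  fixes N :: "('n::finite \<Rightarrow> int) \<Rightarrow> (nat \<Rightarrow> 'k::field) set"
  assumes N: "graded_module m N" and nonneg: "\<And>\<beta> w. w \<in> N \<beta> \<Longrightarrow> w \<noteq> 0 \<Longrightarrow> 0 \<le> \<beta>"
  shows "finite {\<beta>. \<not> N \<beta> \<subseteq> fs.span (\<Union>\<gamma>\<in>{..<\<beta>}. N \<gamma>)}" (is "finite ?B")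
proof (rule ccontr)
  assume "infinite ?B"
  then obtain s :: "nat \<Rightarrow> 'n \<Rightarrow> int" where s: "inj s" "range s \<subseteq> ?B"
    using infinite_countable_subset by blast
  have sub: "fs.subspace (N \<beta>)" for \<beta> using N by (simp add: graded_module_def)
  have fin: "\<forall>w\<in>N \<beta>. \<forall>j. j \<notin> {..<m} \<longrightarrow> w j = 0" for \<beta> using N by (simp add: graded_module_def not_less)
  have fs: "fin_supp (N \<beta>)" for \<beta> unfolding fin_supp_def using fin by blast
  have "0 \<le> s k" for k
  proof -
    obtain w where w: "w \<in> N (s k)" "w \<notin> fs.span (\<Union>\<gamma>\<in>{..<s k}. N \<gamma>)" using s(2) by blast
    have "w \<noteq> 0" using w(2) fs.span_zero by metis
    then show ?thesis using w(1) nonneg by blast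
  qed
  then obtain f where f: "strict_mono f" "incseq (\<lambda>k. s (f k))" by (rule dickson)
  have less: "s (f k) < s (f (Suc k))" for k
  proof -
    have "f k \<noteq> f (Suc k)" using f(1) by (metis n_not_Suc_n strict_mono_eq)
    then have "s (f k) \<noteq> s (f (Suc k))" using s(1) by (auto dest: injD)
    then show ?thesis using incseq_SucD[OF f(2), of k] by (simp add: order_less_le)
  qed
  have "k \<le> fs.dim (N (s (f k)))" for k
  proof (induction k)
    case (Suc k)
    have mono: "N (s (f k)) \<subseteq> N (s (f (Suc k)))"
      using N less[of k] unfolding graded_module_def by (meson order_less_imp_le)
    have "N (s (f k)) \<noteq> N (s (f (Suc k)))"
    proof
      assume eq: "N (s (f k)) = N (s (f (Suc k)))"
      have "N (s (f k)) \<subseteq> (\<Union>\<gamma>\<in>{..<s (f (Suc k))}. N \<gamma>)" using less[of k] by blast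
      then have "N (s (f (Suc k))) \<subseteq> fs.span (\<Union>\<gamma>\<in>{..<s (f (Suc k))}. N \<gamma>)"
        unfolding eq using fs.span_superset by (rule subset_trans)
      moreover have "s (f (Suc k)) \<in> ?B" using s(2) by blast
      ultimately show False by blast
    qed
    then have "fs.dim (N (s (f k))) < fs.dim (N (s (f (Suc k))))"
      using dim_equal_subspace[OF fs sub mono] by (meson not_le)
    then show ?case using Suc by simp
  qed simp
  from this[of "Suc m"] show False
    using fin_supp_dim_le[OF finite_lessThan fin, of "s (f (Suc m))"] by simp
qed

lemma subspace_free_part: "fs.subspace (free_part n b \<beta> :: (nat \<Rightarrow> 'k::field) set)"
proof -
  have "graded_module n (free_part n b :: _ \<Rightarrow> (nat \<Rightarrow> 'k) set)" by (rule graded_module_free_part)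
  then show ?thesis by (simp add: graded_module_def)
qed

lemma subspace_mat_image: "fs.subspace (mat m n c ` free_part n b \<beta>)"
  by (rule subspace_image[OF lin_mat subspace_free_part])

text \<open>Generators are taken only in the finitely many degrees where \<open>N\<close> is not
  spanned by smaller components; elsewhere induction on the total degree applies. Nonnegative
  generator degrees are recorded so that the kernel of the matrix satisfies the same hypotheses and
  the construction can be iterated.\<close>

lemma graded_module_generators:
  fixes N :: "('n::finite \<Rightarrow> int) \<Rightarrow> (nat \<Rightarrow> 'k::field) set"
  assumes N: "graded_module m N" and Na: "\<And>\<beta>. N \<beta> \<subseteq> free_part m a \<beta>"
    and nonneg: "\<And>\<beta> w. w \<in> N \<beta> \<Longrightarrow> w \<noteq> 0 \<Longrightarrow> 0 \<le> \<beta>"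
  obtains n b c where "\<And>j. j < n \<Longrightarrow> 0 \<le> b j" "graded_matrix m n a b c"
    "\<And>\<beta>. mat m n c ` free_part n b \<beta> = N \<beta>"
proof -
  have sub: "fs.subspace (N \<beta>)" for \<beta> using N by (simp add: graded_module_def)
  have mono: "\<beta> \<le> \<gamma> \<Longrightarrow> N \<beta> \<subseteq> N \<gamma>" for \<beta> \<gamma> using N by (simp add: graded_module_def)
  have supp: "w j = 0" if "w \<in> N \<beta>" "m \<le> j" for w \<beta> j using N that by (auto simp: graded_module_def)
  have fs: "fin_supp (N \<beta>)" for \<beta>
    unfolding fin_supp_def using supp by (intro exI[of _ "{..<m}"]) (auto simp: not_less)
  define J where "J = {\<beta>. \<not> N \<beta> \<subseteq> fs.span (\<Union>\<gamma>\<in>{..<\<beta>}. N \<gamma>)}"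
  have finJ: "finite J" unfolding J_def by (rule finite_jumps[OF N nonneg])
  have "\<exists>B. B \<subseteq> N \<beta> \<and> N \<beta> \<subseteq> fs.span B \<and> finite B" for \<beta>
    by (rule fin_supp_basis_exists[OF fs[of \<beta>]]) auto
  from choice[OF allI[OF this]] obtain B where B: "\<forall>\<beta>. B \<beta> \<subseteq> N \<beta> \<and> N \<beta> \<subseteq> fs.span (B \<beta>) \<and> finite (B \<beta>)" ..
  define G where "G = (SIGMA \<beta>:J. B \<beta>)"
  have "finite G" unfolding G_def using finJ B by auto
  then obtain n and e :: "nat \<Rightarrow> ('n \<Rightarrow> int) \<times> (nat \<Rightarrow> 'k)" where e: "G = e ` {i. i < n}"
    using finite_imp_nat_seg_image_inj_on by metis
  define b where "b j = fst (e j)" for j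
  define c where "c k j = snd (e j) k" for k j
  have ej: "b j \<in> J" "(\<lambda>k. c k j) \<in> N (b j)" if "j < n" for j
  proof -
    have "e j \<in> G" using e that by blast
    then obtain \<beta> u where "e j = (\<beta>, u)" "\<beta> \<in> J" "u \<in> B \<beta>" by (auto simp: G_def)
    moreover have "B \<beta> \<subseteq> N \<beta>" using B by blast
    ultimately show "b j \<in> J" "(\<lambda>k. c k j) \<in> N (b j)" by (auto simp: b_def c_def)
  qed
  show thesis
  proof
    show "0 \<le> b j" if j: "j < n" for j
    proof -
      obtain w where w: "w \<in> N (b j)" "w \<notin> fs.span (\<Union>\<gamma>\<in>{..<b j}. N \<gamma>)"
        using ej(1)[OF j] unfolding J_def by blast
      have "w \<noteq> 0" using w(2) fs.span_zero by metis
      then show ?thesis using w(1) nonneg by blast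
    qed
    show "graded_matrix m n a b c"
      using ej(2) Na by (fastforce simp: graded_matrix_def free_part_def)
    fix \<beta>
    have "mat m n c w \<in> N \<beta>" if w: "w \<in> free_part n b \<beta>" for w
    proof -
      have col: "(\<lambda>k. w j * c k j) \<in> N \<beta>" if j: "j \<in> {..<n}" for j
      proof (cases "w j = 0")
        case True
        then show ?thesis using sub[of \<beta>] by (simp add: subspace_iff zero_fun_def)
      next
        case False
        then have "b j \<le> \<beta>" using w by (auto simp: free_part_def)
        then have "(\<lambda>k. c k j) \<in> N \<beta>" using mono ej(2) j by blast
        then show ?thesis using sub[of \<beta>] unfolding subspace_iff by fast
      qed
      have "mat m n c w = (\<lambda>k. \<Sum>j<n. w j * c k j)"
        using supp[OF ej(2)] by (auto simp: mat_def fun_eq_iff mult.commute)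
      then show ?thesis using subspace_sum_pointwise[OF sub[of \<beta>] col, of "{..<n}" "\<lambda>j. j"] by simp
    qed
    moreover have "N \<beta> \<subseteq> mat m n c ` free_part n b \<beta>"
    \<comment> \<open>A nonzero component below \<open>\<beta>\<close> has nonnegative degree, so
      the total degree drops even after truncation by \<open>nat\<close>.\<close>
    proof (induction "nat (\<Sum>l\<in>UNIV. \<beta> l)" arbitrary: \<beta> rule: less_induct)
      case less
      let ?I = "mat m n c ` free_part n b \<beta>"
      show ?case
      proof (cases "\<beta> \<in> J")
        case True
        have "B \<beta> \<subseteq> ?I"
        proof
          fix u assume u: "u \<in> B \<beta>"
          then have "(\<beta>, u) \<in> G" using True by (simp add: G_def)
          then obtain j where "j < n" "e j = (\<beta>, u)" using e by auto
          then have j: "j < n" "b j = \<beta>" "(\<lambda>k. c k j) = u" by (auto simp: b_def c_def)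
          let ?w = "\<lambda>i. if i = j then 1 else 0"
          have "mat m n c ?w = (\<lambda>k. if k < m then c k j else 0)"
            using j(1) by (auto simp: mat_def fun_eq_iff if_distrib cong: if_cong)
          also have "\<dots> = u" using supp[OF ej(2)[OF j(1)]] j(3) by auto
          finally have "u = mat m n c ?w" by simp
          moreover have "?w \<in> free_part n b \<beta>" using j by (simp add: free_part_def)
          ultimately show "u \<in> ?I" by (rule image_eqI)
        qed
        then have "fs.span (B \<beta>) \<subseteq> ?I" by (rule fs.span_minimal[OF _ subspace_mat_image])
        then show ?thesis using B by blast
      next
        case False
        have "(\<Union>\<gamma>\<in>{..<\<beta>}. N \<gamma>) \<subseteq> ?I"
        proof clarify
          fix \<gamma> w assume \<gamma>: "\<gamma> < \<beta>" and w: "w \<in> N \<gamma>"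
          have "w \<in> mat m n c ` free_part n b \<gamma>"
          proof (cases "w = 0")
            case True
            then show ?thesis using subspace_mat_image[of m n c b \<gamma>] by (simp add: subspace_iff)
          next
            case False
            then have "0 \<le> \<gamma>" using w nonneg by blast
            then have "0 \<le> (\<Sum>l\<in>UNIV. \<gamma> l)" by (intro sum_nonneg) (simp add: le_fun_def)
            moreover have "\<gamma> \<le> \<beta>" "\<not> \<beta> \<le> \<gamma>" using \<gamma> by auto
            then have "(\<Sum>l\<in>UNIV. \<gamma> l) < (\<Sum>l\<in>UNIV. \<beta> l)"
              by (intro sum_strict_mono_ex1) (auto simp: le_fun_def not_le)
            ultimately have "N \<gamma> \<subseteq> mat m n c ` free_part n b \<gamma>" by (intro less) simp
            then show ?thesis using w by blast
          qed
          then show "w \<in> ?I" using free_part_mono[of \<gamma> \<beta> n b] \<gamma> by (auto dest: order_less_imp_le)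
        qed
        then have "fs.span (\<Union>\<gamma>\<in>{..<\<beta>}. N \<gamma>) \<subseteq> ?I" by (rule fs.span_minimal[OF _ subspace_mat_image])
        then show ?thesis using False by (auto simp: J_def)
      qed
    qed
    ultimately show "mat m n c ` free_part n b \<beta> = N \<beta>" by blast
  qed
qed

lemma graded_resolution_exists:
  fixes N :: "('n::finite \<Rightarrow> int) \<Rightarrow> (nat \<Rightarrow> 'k::field) set"
  assumes N: "graded_module m N" and Na: "\<And>\<beta>. N \<beta> \<subseteq> free_part m a \<beta>"
    and nonneg: "\<And>\<beta> w. w \<in> N \<beta> \<Longrightarrow> w \<noteq> 0 \<Longrightarrow> 0 \<le> \<beta>"
  obtains r d c where "graded_resolution r d c" "r 0 = m" "d 0 = a"
    "\<And>\<beta>. graded_resolution.syz r d c 0 \<beta> = N \<beta>"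
proof -
  \<comment> \<open>A state is a matrix together with ranks and degrees of its target and source.
    \<open>P\<close> carries the invariant and gives the initial matrix the image \<open>N\<close>;
    \<open>Q\<close> makes the next matrix generate the kernel of the current one.\<close>
  define P :: "nat \<Rightarrow> nat \<times> (nat \<Rightarrow> 'n \<Rightarrow> int) \<times> nat \<times> (nat \<Rightarrow> 'n \<Rightarrow> int) \<times> (nat \<Rightarrow> nat \<Rightarrow> 'k) \<Rightarrow> bool" where
    "P i x = (case x of (m', a', n, b, c) \<Rightarrow> graded_matrix m' n a' b c \<and> (\<forall>j<n. 0 \<le> b j) \<and>
      (i = 0 \<longrightarrow> m' = m \<and> a' = a \<and> (\<forall>\<beta>. mat m n c ` free_part n b \<beta> = N \<beta>)))" for i x
  define Q :: "nat \<Rightarrow> nat \<times> (nat \<Rightarrow> 'n \<Rightarrow> int) \<times> nat \<times> (nat \<Rightarrow> 'n \<Rightarrow> int) \<times> (nat \<Rightarrow> nat \<Rightarrow> 'k) \<Rightarrow>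
      nat \<times> (nat \<Rightarrow> 'n \<Rightarrow> int) \<times> nat \<times> (nat \<Rightarrow> 'n \<Rightarrow> int) \<times> (nat \<Rightarrow> nat \<Rightarrow> 'k) \<Rightarrow> bool" where
    "Q i x y = (case x of (m', a', n, b, c) \<Rightarrow> case y of (n', b', l, d, c') \<Rightarrow> n' = n \<and> b' = b \<and>
      (\<forall>\<beta>. {w\<in>free_part n b \<beta>. mat m' n c w = 0} = mat n l c' ` free_part l d \<beta>))" for i x y
  have "\<exists>f. \<forall>i. P i (f i) \<and> Q i (f i) (f (Suc i))"
  proof (rule dependent_nat_choice)
    obtain n b c where "\<And>j. j < n \<Longrightarrow> 0 \<le> b j" "graded_matrix m n a b c"
      "\<And>\<beta>. mat m n c ` free_part n b \<beta> = N \<beta>"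
      by (rule graded_module_generators[OF N Na nonneg]) blast+
    then show "\<exists>x. P 0 x" by (intro exI[of _ "(m, a, n, b, c)"]) (simp add: P_def)
  next
    fix x i assume x: "P i x"
    obtain m' a' n b c where x_eq: "x = (m', a', n, b, c)" by (cases x)
    let ?K = "\<lambda>\<beta>. {w\<in>free_part n b \<beta>. mat m' n c w = 0}"
    have K: "graded_module n ?K"
      unfolding graded_module_def
    proof (intro conjI allI impI ballI)
      show "fs.subspace (?K \<beta>)" for \<beta> by (rule subspace_kernel[OF lin_mat subspace_free_part])
      show "?K \<beta> \<subseteq> ?K \<gamma>" if "\<beta> \<le> \<gamma>" for \<beta> \<gamma> using free_part_mono[OF that, of n b] by blast
      show "w j = 0" if "w \<in> ?K \<beta>" "n \<le> j" for \<beta> w j using that by (auto simp: free_part_def)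
    qed
    have Kpos: "0 \<le> \<beta>" if w: "w \<in> ?K \<beta>" "w \<noteq> 0" for w \<beta>
    proof -
      obtain j where "w j \<noteq> 0" using w(2) by (auto simp: fun_eq_iff)
      then have "j < n" "b j \<le> \<beta>" using w(1) by (auto simp: free_part_def)
      then show ?thesis using x by (auto simp: P_def x_eq intro: order_trans)
    qed
    obtain l d c' where "\<And>j. j < l \<Longrightarrow> 0 \<le> d j" "graded_matrix n l b d c'"
      "\<And>\<beta>. mat n l c' ` free_part l d \<beta> = ?K \<beta>"
      by (rule graded_module_generators[OF K _ Kpos, of b]) blast+
    then show "\<exists>y. P (Suc i) y \<and> Q i x y"
      by (intro exI[of _ "(n, b, l, d, c')"]) (simp add: P_def Q_def x_eq)
  qed
  then obtain f where f: "\<And>i. P i (f i)" "\<And>i. Q i (f i) (f (Suc i))" by blast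
  define r where "r i = fst (f i)" for i
  define d where "d i = fst (snd (f i))" for i
  define c where "c i = snd (snd (snd (snd (f i))))" for i
  have next_eq: "fst (snd (snd (f i))) = r (Suc i)" "fst (snd (snd (snd (f i)))) = d (Suc i)" for i
    using f(2)[of i] by (auto simp: Q_def r_def d_def split: prod.splits)
  have f_eq: "f i = (r i, d i, r (Suc i), d (Suc i), c i)" for i
    using next_eq[of i] by (metis r_def d_def c_def prod.collapse)
  have R: "graded_resolution r d c"
  proof
    show "graded_matrix (r q) (r (Suc q)) (d q) (d (Suc q)) (c q)" for q
      using f(1)[of q] by (simp add: P_def f_eq[of q])
    show "{w \<in> free_part (r (Suc q)) (d (Suc q)) \<beta>. mat (r q) (r (Suc q)) (c q) w = 0} =
        mat (r (Suc q)) (r (Suc (Suc q))) (c (Suc q)) ` free_part (r (Suc (Suc q))) (d (Suc (Suc q))) \<beta>" for q \<beta>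
      using f(2)[of q] by (simp add: Q_def f_eq[of q] f_eq[of "Suc q"])
  qed
  have "r 0 = m" "d 0 = a" "\<And>\<beta>. mat (r 0) (r (Suc 0)) (c 0) ` free_part (r (Suc 0)) (d (Suc 0)) \<beta> = N \<beta>"
    using f(1)[of 0] by (simp_all add: P_def f_eq[of 0])
  then show thesis using that[OF R] by (simp add: graded_resolution.syz_def[OF R])
qed

definition exponent_set :: "('n \<Rightarrow> int) set \<Rightarrow> bool" where
  "exponent_set A \<longleftrightarrow> (\<forall>\<beta>\<in>A. 0 \<le> \<beta> \<and> (\<forall>\<gamma>\<ge>\<beta>. \<gamma> \<in> A))"

lemma graded_module_ideal_part:
  assumes "exponent_set A"
  shows "graded_module 1 (ideal_part A :: _ \<Rightarrow> (nat \<Rightarrow> 'k::field) set)"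
  unfolding graded_module_def
proof (intro conjI allI impI ballI)
  show "fs.subspace (ideal_part A \<beta> :: (nat \<Rightarrow> 'k) set)" for \<beta>
    unfolding subspace_iff ideal_part_def by (auto, (metis add_0)+)
  show "(ideal_part A \<beta> :: (nat \<Rightarrow> 'k) set) \<subseteq> ideal_part A \<gamma>" if "\<beta> \<le> \<gamma>" for \<beta> \<gamma>
    using assms that by (auto simp: ideal_part_def exponent_set_def)
  show "w j = 0" if "w \<in> ideal_part A \<beta>" "1 \<le> j" for \<beta> j and w :: "nat \<Rightarrow> 'k"
    using that by (auto simp: ideal_part_def)
qed

lemma free_resolution_exists:
  fixes A :: "('n::finite \<Rightarrow> int) set"
  assumes A: "exponent_set A"
  obtains F :: "('n, 'k::field) graded_seq" where "free_resolution F (supported A)"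
proof -
  have A0: "0 \<le> \<beta>" if "\<beta> \<in> A" for \<beta> using A that by (simp add: exponent_set_def)
  obtain r d and c :: "nat \<Rightarrow> nat \<Rightarrow> nat \<Rightarrow> 'k" where R: "graded_resolution r d c" "r 0 = 1" "d 0 = (\<lambda>_. 0)"
    "\<And>\<beta>. graded_resolution.syz r d c 0 \<beta> = ideal_part A \<beta>"
  proof (rule graded_resolution_exists[OF graded_module_ideal_part[OF A]])
    show "(ideal_part A \<beta> :: (nat \<Rightarrow> 'k) set) \<subseteq> free_part 1 (\<lambda>_. 0) \<beta>" for \<beta>
      using A0 by (auto simp: ideal_part_def free_part_def)
    show "0 \<le> \<beta>" if "w \<in> ideal_part A \<beta>" "w \<noteq> 0" for \<beta> and w :: "nat \<Rightarrow> 'k"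
      using that A0 by (auto simp: ideal_part_def fun_eq_iff)
  qed (rule that)
  define F :: "('n, 'k) graded_seq" where
    "F = \<lparr>grank = \<lambda>q. r (Suc q), gdeg = \<lambda>q. d (Suc q), aug = \<lambda>j. gmonom (d 1 j) (c 0 0 j),
      gdiff = \<lambda>q k j. gmonom (d (Suc (Suc q)) j - d (Suc q) k) (c (Suc q) k j)\<rparr>"
  have r: "step_rank F = r" and d: "step_deg F = d"
    using R(2,3) by (auto simp: step_rank_def step_deg_def F_def fun_eq_iff split: nat.splits)
  have "matches (step_rank F q) (step_rank F (Suc q)) (step_deg F q) (step_deg F (Suc q)) (c q) (step_diff F q)" for q
  proof (cases q)
    case 0
    then show ?thesis using graded_resolution.graded[OF R(1), of 0] R(2,3)
      by (simp add: matches_def r d) (simp add: step_diff_def F_def fun_diff_def)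
  next
    case (Suc q')
    have "step_diff F (Suc q') k j = gmonom (d (Suc (Suc q')) j - d (Suc q') k) (c (Suc q') k j)" for k j
      by (simp add: step_diff_def F_def)
    then show ?thesis using graded_resolution.graded[OF R(1), of q] Suc by (simp add: matches_def r d)
  qed
  then have "free_resolution F (supported A)"
    using free_resolution_iff[of F c A] A0 R(1,4) by (simp add: r d)
  then show thesis by (rule that)
qed

text \<open>Existence ensures that the choice in \<open>betti\<close> returns a resolution; any
  resolution gives the same value.\<close>

lemma betti_eq_kos_dim:
  fixes A :: "('n::finite \<Rightarrow> int) set"
  assumes A: "exponent_set A"
  shows "betti i \<alpha> (supported A :: ('n, 'k::field) mpoly set) = kos_dim (ideal_part A :: _ \<Rightarrow> (nat \<Rightarrow> 'k) set) i \<alpha>"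
proof -
  have "\<exists>F :: ('n, 'k) graded_seq. free_resolution F (supported A)"
    by (rule free_resolution_exists[OF A]) blast
  then have "free_resolution (SOME F :: ('n, 'k) graded_seq. free_resolution F (supported A)) (supported A)"
    by (rule someI_ex)
  then show ?thesis
    unfolding betti_def using A by (intro tor_dim_eq_kos_dim) (auto simp: exponent_set_def)
qed

section \<open>Monomial ideals\<close>

interpretation mpoly: module "(*) :: ('n, 'k::field) mpoly \<Rightarrow> ('n, 'k) mpoly \<Rightarrow> ('n, 'k) mpoly"
  by unfold_locales (simp_all add: algebra_simps)

definition up_closure :: "('n \<Rightarrow>\<^sub>0 nat) set \<Rightarrow> ('n \<Rightarrow> int) set" where
  "up_closure S = {\<beta>. \<exists>m\<in>S. expo m \<le> \<beta>}"

lemma exponent_set_up_closure: "exponent_set (up_closure S)"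
  unfolding exponent_set_def up_closure_def using expo_nonneg by (blast intro: order_trans)

lemma exponent_set_Int: "exponent_set A \<Longrightarrow> exponent_set B \<Longrightarrow> exponent_set (A \<inter> B)"
  by (auto simp: exponent_set_def)

lemma exponent_set_Un: "exponent_set A \<Longrightarrow> exponent_set B \<Longrightarrow> exponent_set (A \<union> B)"
  by (auto simp: exponent_set_def)

lemma subspace_supported:
  assumes A: "exponent_set A"
  shows "mpoly.subspace (supported A :: ('n, 'k::field) mpoly set)"
  unfolding mpoly.subspace_def
proof (intro conjI ballI allI)
  show "(0 :: ('n, 'k) mpoly) \<in> supported A" by (simp add: supported_def)
  show "p + q \<in> supported A" if "p \<in> supported A" "q \<in> supported A" for p q :: "('n, 'k) mpoly"
    using that Poly_Mapping.keys_add[of p q] by (auto simp: supported_def)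
  show "p * q \<in> supported A" if q: "q \<in> supported A" for p q :: "('n, 'k) mpoly"
    unfolding supported_def
  proof (intro CollectI ballI)
    fix m assume "m \<in> Poly_Mapping.keys (p * q)"
    then obtain m1 m2 where m: "m = m1 + m2" "m2 \<in> Poly_Mapping.keys q"
      using keys_mult[of p q] by blast
    have "expo m2 \<le> expo m" by (simp add: m(1) expo_add expo_def le_fun_def lookup_add)
    then show "expo m \<in> A" using q m(2) A by (auto simp: supported_def exponent_set_def)
  qed
qed

lemma sum_monomials:
  fixes p :: "('n, 'k::field) mpoly"
  shows "p = (\<Sum>m\<in>Poly_Mapping.keys p. Poly_Mapping.single m (Poly_Mapping.lookup p m))"
proof (rule poly_mapping_eqI)
  fix k
  have "Poly_Mapping.lookup (\<Sum>m\<in>Poly_Mapping.keys p. Poly_Mapping.single m (Poly_Mapping.lookup p m)) k =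
      (\<Sum>m\<in>Poly_Mapping.keys p. if k = m then Poly_Mapping.lookup p m else 0)"
    by (simp add: lookup_sum lookup_single when_def eq_commute)
  also have "\<dots> = Poly_Mapping.lookup p k" by (simp add: in_keys_iff)
  finally show "Poly_Mapping.lookup p k =
    Poly_Mapping.lookup (\<Sum>m\<in>Poly_Mapping.keys p. Poly_Mapping.single m (Poly_Mapping.lookup p m)) k" ..
qed

lemma expo_le_imp_add:
  fixes m m' :: "'n::finite \<Rightarrow>\<^sub>0 nat"
  assumes "expo m \<le> expo m'"
  shows "m' = of_expo (expo m' - expo m) + m"
proof (rule poly_mapping_eqI)
  fix l show "Poly_Mapping.lookup m' l = Poly_Mapping.lookup (of_expo (expo m' - expo m) + m) l"
    using le_funD[OF assms, of l] by (simp add: lookup_add expo_def)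
qed

lemma ideal_gen_monoms:
  fixes S :: "('n::finite \<Rightarrow>\<^sub>0 nat) set"
  shows "ideal_gen (monom ` S :: ('n, 'k::field) mpoly set) = supported (up_closure S)"
proof
  show "ideal_gen (monom ` S :: ('n, 'k) mpoly set) \<subseteq> supported (up_closure S)"
    by (rule mpoly.span_minimal[OF _ subspace_supported[OF exponent_set_up_closure]])
       (auto simp: supported_def monom_def up_closure_def)
  show "supported (up_closure S) \<subseteq> ideal_gen (monom ` S :: ('n, 'k) mpoly set)"
  proof
    fix p :: "('n, 'k) mpoly" assume p: "p \<in> supported (up_closure S)"
    have "Poly_Mapping.single m (Poly_Mapping.lookup p m) \<in> ideal_gen (monom ` S :: ('n, 'k) mpoly set)"
      if "m \<in> Poly_Mapping.keys p" for m
    proof -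
      obtain s where s: "s \<in> S" "expo s \<le> expo m"
        using p \<open>m \<in> Poly_Mapping.keys p\<close> by (auto simp: supported_def up_closure_def)
      have "Poly_Mapping.single m (Poly_Mapping.lookup p m) =
          Poly_Mapping.single (of_expo (expo m - expo s)) (Poly_Mapping.lookup p m) * monom s"
        unfolding monom_def mult_single by (simp flip: expo_le_imp_add[OF s(2)])
      also have "\<dots> \<in> ideal_gen (monom ` S)"
        using s(1) by (intro mpoly.span_scale mpoly.span_base) auto
      finally show ?thesis .
    qed
    then have "(\<Sum>m\<in>Poly_Mapping.keys p. Poly_Mapping.single m (Poly_Mapping.lookup p m)) \<in> ideal_gen (monom ` S)"
      by (rule mpoly.span_sum)
    then show "p \<in> ideal_gen (monom ` S)" using sum_monomials[of p] by simp
  qed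
qed

text \<open>Every monomial of a member of a monomial ideal is itself a member, so the homogeneous
  polynomials of degree \<open>d\<close> generate no more than the monomials among them.\<close>

lemma homogeneous_part_supported:
  fixes A :: "('n::finite \<Rightarrow> int) set"
  shows "homogeneous_part d (supported A :: ('n, 'k::field) mpoly set) =
    supported (up_closure {m. expo m \<in> A \<and> (\<Sum>i\<in>UNIV. Poly_Mapping.lookup m i) = d})"
    (is "_ = supported (up_closure ?T)")
proof -
  let ?H = "{p \<in> supported A :: ('n, 'k) mpoly set. \<forall>m \<in> Poly_Mapping.keys p. (\<Sum>i\<in>UNIV. Poly_Mapping.lookup m i) = d}"
  have "?H \<subseteq> supported (up_closure ?T)" by (auto simp: supported_def up_closure_def)
  then have "ideal_gen ?H \<subseteq> supported (up_closure ?T)"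
    by (rule mpoly.span_minimal[OF _ subspace_supported[OF exponent_set_up_closure]])
  moreover have "monom ` ?T \<subseteq> ?H" by (auto simp: supported_def monom_def)
  then have "ideal_gen (monom ` ?T) \<subseteq> ideal_gen ?H" by (rule mpoly.span_mono)
  ultimately show ?thesis unfolding homogeneous_part_def ideal_gen_monoms by blast
qed

lemma monom_inject [simp]: "(monom m :: ('n, 'k::field) mpoly) = monom m' \<longleftrightarrow> m = m'"
proof
  assume "(monom m :: ('n, 'k) mpoly) = monom m'"
  then have "Poly_Mapping.keys (monom m :: ('n, 'k) mpoly) = Poly_Mapping.keys (monom m' :: ('n, 'k) mpoly)" by simp
  then show "m = m'" by (simp add: monom_def)
qed simp

lemma Var_dvd_monom:
  fixes m :: "'n::finite \<Rightarrow>\<^sub>0 nat"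
  shows "(Var i :: ('n, 'k::field) mpoly) dvd monom m \<longleftrightarrow> 1 \<le> Poly_Mapping.lookup m i"
proof
  assume "(Var i :: ('n, 'k) mpoly) dvd monom m"
  then obtain q :: "('n, 'k) mpoly" where q: "monom m = Var i * q" by (elim dvdE)
  have "m \<in> Poly_Mapping.keys (Var i * q)" unfolding q[symmetric] by (simp add: monom_def)
  then obtain m' where "m = Poly_Mapping.single i 1 + m'"
    using keys_mult[of "Var i" q] by (auto simp: Var_def monom_def)
  then show "1 \<le> Poly_Mapping.lookup m i" by (simp add: lookup_add)
next
  assume "1 \<le> Poly_Mapping.lookup m i"
  then have "m = Poly_Mapping.single i 1 + (m - Poly_Mapping.single i 1)"
    by (intro poly_mapping_eqI) (auto simp: lookup_add lookup_minus lookup_single when_def)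
  then have "(monom m :: ('n, 'k) mpoly) = Var i * monom (m - Poly_Mapping.single i 1)"
    by (simp add: Var_def monom_def mult_single)
  then show "(Var i :: ('n, 'k) mpoly) dvd monom m" by (rule dvdI)
qed

lemma supported_Int: "supported A \<inter> supported B = supported (A \<inter> B)"
  by (auto simp: supported_def)

lemma ideal_part_Int: "ideal_part (A \<inter> B) \<beta> = ideal_part A \<beta> \<inter> ideal_part B \<beta>"
  by (auto simp: ideal_part_def)

lemma ideal_part_Un:
  "(ideal_part (A \<union> B) \<beta> :: (nat \<Rightarrow> 'k::field) set) = {x + y |x y. x \<in> ideal_part A \<beta> \<and> y \<in> ideal_part B \<beta>}"
proof
  show "(ideal_part (A \<union> B) \<beta> :: (nat \<Rightarrow> 'k) set) \<subseteq> {x + y |x y. x \<in> ideal_part A \<beta> \<and> y \<in> ideal_part B \<beta>}"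
  proof
    fix w :: "nat \<Rightarrow> 'k" assume w: "w \<in> ideal_part (A \<union> B) \<beta>"
    have "w = (if \<beta> \<in> A then w else 0) + (if \<beta> \<in> A then 0 else w)" by simp
    moreover have "(if \<beta> \<in> A then w else 0) \<in> ideal_part A \<beta>" "(if \<beta> \<in> A then 0 else w) \<in> ideal_part B \<beta>"
      using w by (auto simp: ideal_part_def)
    ultimately show "w \<in> {x + y |x y. x \<in> ideal_part A \<beta> \<and> y \<in> ideal_part B \<beta>}" by blast
  qed
  show "{x + y |x y. x \<in> ideal_part A \<beta> \<and> y \<in> ideal_part B \<beta>} \<subseteq> (ideal_part (A \<union> B) \<beta> :: (nat \<Rightarrow> 'k) set)"
    by (auto simp: ideal_part_def) (metis add_0)+
qed

text \<open>With one module coordinate, chains are scalar functions on sets of variables; for an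
  exponent set \<open>A\<close>, these sets are faces of the upper Koszul simplicial
  complex.\<close>

lemma kos_ideal_part_iff:
  "t \<in> kos (ideal_part A) p \<alpha> \<longleftrightarrow>
    (\<forall>\<sigma> k. t (\<sigma>, k) \<noteq> 0 \<longrightarrow> card \<sigma> = p \<and> k = 0 \<and> shift \<alpha> \<sigma> \<in> A)"
  by (auto simp: kos_def ideal_part_def)

lemma kos_bounds_ideal_part_mono:
  "A \<subseteq> B \<Longrightarrow> kos_bounds (ideal_part A) p \<alpha> \<subseteq> kos_bounds (ideal_part B) p \<alpha>"
  unfolding kos_bounds_def by (intro image_mono) (fastforce simp: kos_ideal_part_iff)

lemma shift_shift:
  assumes "l \<in> \<sigma>"
  shows "shift (shift \<alpha> (\<sigma> - {l})) {l} = shift \<alpha> \<sigma>"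
  using assms by (auto simp: shift_def fun_eq_iff)

lemma sum_shift: "(\<Sum>l\<in>UNIV. shift \<alpha> \<sigma> l) = (\<Sum>l\<in>UNIV. \<alpha> l) - int (card \<sigma>)"
  for \<sigma> :: "'n::finite set"
  by (simp add: shift_def sum_subtractf sum.If_cases)

text \<open>
  \<open>A\<close> and \<open>B\<close> are the exponents of \<open>J\<close> and \<open>J \<inter> K \<subseteq> \<mm> J\<close>. The coefficients of a cycle over \<open>J \<inter> K\<close>
  in homological degree \<open>p\<close> and degree \<open>\<alpha>\<close> have degree \<open>d + 1 = \<bar>\<alpha>\<bar> - p\<close>, so it is a cycle over \<open>J\<^bsub>(d)\<^esub>\<close>, where it bounds because the
  resolution of \<open>J\<^bsub>(d)\<^esub>\<close> is linear.
\<close>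

lemma kos_cycles_null_componentwise_linear:
  fixes A B :: "('n::finite \<Rightarrow> int) set"
  assumes A: "exponent_set A" and lin: "componentwise_linear (supported A :: ('n, 'k::field) mpoly set)"
    and step: "\<And>\<beta>. \<beta> \<in> B \<Longrightarrow> \<exists>l. shift \<beta> {l} \<in> A"
  shows "kos_cycles (ideal_part B :: _ \<Rightarrow> (nat \<Rightarrow> 'k) set) p \<alpha> \<subseteq> kos_bounds (ideal_part A) p \<alpha>"
proof
  fix t :: "'n set \<times> nat \<Rightarrow> 'k" assume t: "t \<in> kos_cycles (ideal_part B) p \<alpha>"
  have supp: "card \<sigma> = p \<and> k = 0 \<and> shift \<alpha> \<sigma> \<in> B" if "t (\<sigma>, k) \<noteq> 0" for \<sigma> k
    using t that by (simp add: kos_cycles_def kos_ideal_part_iff)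
  have deg: "0 \<le> (\<Sum>l\<in>UNIV. \<gamma> l)" if "\<gamma> \<in> A" for \<gamma>
    using that A by (intro sum_nonneg) (auto simp: exponent_set_def le_fun_def)
  have sub: "fs.subspace (kos_bounds (ideal_part A :: _ \<Rightarrow> (nat \<Rightarrow> 'k) set) p \<alpha>)"
    by (rule subspace_kos_bounds[OF graded_module_ideal_part[OF A]])
  show "t \<in> kos_bounds (ideal_part A) p \<alpha>"
  proof (cases "t = 0")
    case True
    then show ?thesis using sub by (simp add: subspace_iff)
  next
    case False
    then obtain z where z: "t z \<noteq> 0" by (auto simp: fun_eq_iff)
    obtain \<sigma>0 k0 where "z = (\<sigma>0, k0)" by (cases z)
    then have 0: "card \<sigma>0 = p" "shift \<alpha> \<sigma>0 \<in> B" using supp z by auto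
    \<comment> \<open>A nonzero coefficient exhibits an element of \<open>A\<close> of total degree
      |\<alpha>| - p - 1, so \<open>d\<close> below represents this integer without
      truncation.\<close>
    obtain l0 where "shift (shift \<alpha> \<sigma>0) {l0} \<in> A" using step[OF 0(2)] ..
    from deg[OF this] have ge: "0 \<le> (\<Sum>l\<in>UNIV. \<alpha> l) - int p - 1" by (simp add: sum_shift 0(1))
    define d where "d = nat ((\<Sum>l\<in>UNIV. \<alpha> l) - int p - 1)"
    have d: "int d = (\<Sum>l\<in>UNIV. \<alpha> l) - int p - 1" using ge by (simp add: d_def)
    define T where "T = {m. expo m \<in> A \<and> (\<Sum>i\<in>UNIV. Poly_Mapping.lookup m i) = d}"
    have T: "up_closure T \<subseteq> A" using A by (auto simp: T_def up_closure_def exponent_set_def)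
    have "shift \<alpha> \<sigma> \<in> up_closure T" if "t (\<sigma>, k) \<noteq> 0" for \<sigma> k
    proof -
      have \<sigma>: "card \<sigma> = p" "shift \<alpha> \<sigma> \<in> B" using supp[OF that] by auto
      obtain l where l: "shift (shift \<alpha> \<sigma>) {l} \<in> A" using step[OF \<sigma>(2)] ..
      let ?\<gamma> = "shift (shift \<alpha> \<sigma>) {l}"
      have \<gamma>: "0 \<le> ?\<gamma>" using l A by (simp add: exponent_set_def)
      have "int (\<Sum>i\<in>UNIV. Poly_Mapping.lookup (of_expo ?\<gamma>) i) = (\<Sum>i\<in>UNIV. ?\<gamma> i)"
        using \<gamma> by (simp add: le_fun_def)
      also have "\<dots> = int d" by (simp add: sum_shift \<sigma>(1) d)
      finally have "(\<Sum>i\<in>UNIV. Poly_Mapping.lookup (of_expo ?\<gamma>) i) = d" by (simp only: of_nat_eq_iff)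
      then have "of_expo ?\<gamma> \<in> T" using l \<gamma> by (simp add: T_def del: lookup_of_expo)
      moreover have "?\<gamma> \<le> shift \<alpha> \<sigma>" using shift_antimono[of "{}" "{l}" "shift \<alpha> \<sigma>"] by simp
      ultimately show ?thesis using \<gamma> by (auto simp: up_closure_def intro!: bexI[of _ "of_expo ?\<gamma>"])
    qed
    then have cyc: "t \<in> kos_cycles (ideal_part (up_closure T)) p \<alpha>"
      using t supp by (auto simp: kos_cycles_def kos_ideal_part_iff)
    have "betti p \<alpha> (homogeneous_part d (supported A) :: ('n, 'k) mpoly set) = 0"
      using lin d by (simp add: componentwise_linear_def linear_resolution_def)
    then have "kos_dim (ideal_part (up_closure T) :: _ \<Rightarrow> (nat \<Rightarrow> 'k) set) p \<alpha> = 0"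
      unfolding homogeneous_part_supported T_def[symmetric] betti_eq_kos_dim[OF exponent_set_up_closure] .
    then have "t \<in> kos_bounds (ideal_part (up_closure T)) p \<alpha>"
      using kos_dim_eq_0[OF graded_module_ideal_part[OF exponent_set_up_closure]] cyc by blast
    then show ?thesis using kos_bounds_ideal_part_mono[OF T] by blast
  qed
qed

lemma kos_cycles_null_cone:
  fixes A B :: "('n::finite \<Rightarrow> int) set"
  assumes step: "\<And>\<beta>. \<beta> \<in> B \<Longrightarrow> shift \<beta> {i} \<in> A"
  shows "kos_cycles (ideal_part B :: _ \<Rightarrow> (nat \<Rightarrow> 'k::field) set) p \<alpha> \<subseteq> kos_bounds (ideal_part A) p \<alpha>"
proof
  fix t :: "'n set \<times> nat \<Rightarrow> 'k" assume t: "t \<in> kos_cycles (ideal_part B) p \<alpha>"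
  have "cone (\<lambda>_. i) t \<in> kos (ideal_part A) (Suc p) \<alpha>"
    unfolding kos_ideal_part_iff
  proof (intro allI impI)
    fix \<sigma> and k :: nat assume "cone (\<lambda>_. i) t (\<sigma>, k) \<noteq> 0"
    then have i: "i \<in> \<sigma>" and "t (\<sigma> - {i}, k) \<noteq> 0" by (auto simp: cone_def split: if_splits)
    then have "card (\<sigma> - {i}) = p \<and> k = 0 \<and> shift \<alpha> (\<sigma> - {i}) \<in> B"
      using t by (simp add: kos_cycles_def kos_ideal_part_iff)
    then show "card \<sigma> = Suc p \<and> k = 0 \<and> shift \<alpha> \<sigma> \<in> A"
      using step[of "shift \<alpha> (\<sigma> - {i})"] card.remove[OF finite i] by (simp add: shift_shift[OF i])
  qed
  moreover have "t = bd (cone (\<lambda>_. i) t)" using t bd_cone[of t "\<lambda>_. i"] by (simp add: kos_cycles_def)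
  ultimately show "t \<in> kos_bounds (ideal_part A) p \<alpha>" unfolding kos_bounds_def by blast
qed

theorem theorem5p3:
  fixes I J K :: "('n::finite, 'k::field) mpoly set" and i :: 'n
  assumes "monomial_ideal I"
    and "x_partition i I J K"
    and "componentwise_linear J"
  shows "betti_splitting I J K"
proof -
  obtain G where G: "minimal_monomial_generators G I"
    and JG: "J = ideal_gen {g \<in> G. Var i dvd g}" and KG: "K = ideal_gen {g \<in> G. \<not> Var i dvd g}"
    using assms(2) unfolding x_partition_def by blast
  define S where "S = {m. monom m \<in> G}"
  have GS: "G = monom ` S" using G by (auto simp: minimal_monomial_generators_def S_def)
  define S1 S2 where "S1 = {m\<in>S. 1 \<le> Poly_Mapping.lookup m i}" and "S2 = {m\<in>S. Poly_Mapping.lookup m i = 0}"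
  have S: "S = S1 \<union> S2" by (auto simp: S1_def S2_def)
  define A B where "A = up_closure S1" and "B = up_closure S2"
  have AB: "exponent_set A" "exponent_set B" by (simp_all add: A_def B_def exponent_set_up_closure)
  have "(Var i :: ('n, 'k) mpoly) dvd monom m \<longleftrightarrow> 1 \<le> Poly_Mapping.lookup m i" for m
    by (rule Var_dvd_monom)
  then have "{g \<in> G. Var i dvd g} = monom ` S1" "{g \<in> G. \<not> Var i dvd g} = monom ` S2"
    by (auto simp: GS S1_def S2_def)
  then have J: "J = supported A" and K: "K = supported B"
    by (simp_all add: JG KG ideal_gen_monoms A_def B_def)
  have I: "I = supported (A \<union> B)"
  proof -
    have "up_closure S = A \<union> B" by (auto simp: S A_def B_def up_closure_def)
    then show ?thesis using G ideal_gen_monoms[of S, where 'k = 'k]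
      by (simp add: minimal_monomial_generators_def GS)
  qed
  have stepA: "\<exists>l. shift \<beta> {l} \<in> A" if \<beta>: "\<beta> \<in> A \<inter> B" for \<beta>
  proof -
    obtain m where m: "m \<in> S1" "expo m \<le> \<beta>" using \<beta> by (auto simp: A_def up_closure_def)
    obtain m' where m': "m' \<in> S2" "expo m' \<le> \<beta>" using \<beta> by (auto simp: B_def up_closure_def)
    \<comment> \<open>Minimality of \<open>G\<close> enters here: if \<open>m\<close> had exponent
      \<open>\<beta>\<close>, it would be a multiple of \<open>m'\<close>, a different generator
      because of its exponent at \<open>i\<close>, and \<open>m\<close> could be dropped.\<close>
    have "expo m \<noteq> \<beta>"
    proof
      assume eq: "expo m = \<beta>"
      have ne: "m' \<noteq> m" using m(1) m'(1) by (auto simp: S1_def S2_def)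
      have "up_closure (S - {m}) = up_closure S"
        using m' ne S unfolding up_closure_def eq[symmetric] by (auto intro: order_trans)
      then have "ideal_gen (monom ` (S - {m})) = I"
        using G by (simp add: minimal_monomial_generators_def GS ideal_gen_monoms)
      moreover have "monom m \<in> G" "monom m \<notin> (monom ` (S - {m}) :: ('n, 'k) mpoly set)"
        using m(1) by (auto simp: GS S)
      then have "monom ` (S - {m}) \<subset> G" by (auto simp: GS)
      ultimately show False using G by (auto simp: minimal_monomial_generators_def)
    qed
    \<comment> \<open>Slack in the variable \<open>l\<close> lets it be divided out without leaving
      \<open>A\<close>.\<close>
    then obtain l where "expo m l < \<beta> l" using m(2) by (metis antisym le_funI linorder_not_less)
    then have "expo m \<le> shift \<beta> {l}" using m(2) by (auto simp: shift_def le_fun_def)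
    then show ?thesis using m(1) by (auto simp: A_def up_closure_def)
  qed
  have stepB: "shift \<beta> {i} \<in> B" if \<beta>: "\<beta> \<in> A \<inter> B" for \<beta>
  proof -
    obtain m where m: "m \<in> S1" "expo m \<le> \<beta>" using \<beta> by (auto simp: A_def up_closure_def)
    then have "1 \<le> \<beta> i" using le_funD[OF m(2), of i] by (simp add: S1_def expo_def)
    moreover obtain m' where m': "m' \<in> S2" "expo m' \<le> \<beta>" using \<beta> by (auto simp: B_def up_closure_def)
    ultimately have "expo m' \<le> shift \<beta> {i}" by (auto simp: S2_def expo_def shift_def le_fun_def)
    then show ?thesis using m'(1) by (auto simp: B_def up_closure_def)
  qed
  have "betti p \<alpha> I = betti p \<alpha> J + betti p \<alpha> K + (if p = 0 then 0 else betti (p - 1) \<alpha> (J \<inter> K))" for p \<alpha>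
    unfolding I J K supported_Int betti_eq_kos_dim[OF AB(1)] betti_eq_kos_dim[OF AB(2)]
      betti_eq_kos_dim[OF exponent_set_Int[OF AB]] betti_eq_kos_dim[OF exponent_set_Un[OF AB]]
  proof (rule kos_dim_splitting)
    show "kos_cycles (ideal_part (A \<inter> B) :: _ \<Rightarrow> (nat \<Rightarrow> 'k) set) q \<alpha> \<subseteq> kos_bounds (ideal_part A) q \<alpha>" for q
      using assms(3) by (intro kos_cycles_null_componentwise_linear[OF AB(1) _ stepA]) (simp_all add: J)
    show "kos_cycles (ideal_part (A \<inter> B) :: _ \<Rightarrow> (nat \<Rightarrow> 'k) set) q \<alpha> \<subseteq> kos_bounds (ideal_part B) q \<alpha>" for q
      by (rule kos_cycles_null_cone[OF stepB])
  qed (rule graded_module_ideal_part AB exponent_set_Int exponent_set_Un ideal_part_Int ideal_part_Un)+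
  moreover have "I = {p + q | p q. p \<in> J \<and> q \<in> K}"
  proof
    show "{p + q | p q. p \<in> J \<and> q \<in> K} \<subseteq> I"
      using Poly_Mapping.keys_add by (fastforce simp: I J K supported_def)
    have "I = ideal_gen (monom ` S1 \<union> monom ` S2)"
      using G by (simp add: minimal_monomial_generators_def GS S image_Un)
    then show "I \<subseteq> {p + q | p q. p \<in> J \<and> q \<in> K}"
      by (auto simp: mpoly.span_Un J K A_def B_def ideal_gen_monoms)
  qed
  ultimately show ?thesis unfolding betti_splitting_def by blast
qed

end
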